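(* Let $\Omega\subset E_k$ be a domain. If a function $\Phi:\Omega\to\mathbb{A}_n^m$ is continuous in $\Omega$ and satisfies $$\int_{\partial\triangle}\Phi(\zeta)\,d\zeta=0$$ for every triangle $\triangle$ such that its closure satisfies $\overline{\triangle}\subset\Omega$, then $\Phi$ is monogenic in the domain $\Omega$.
   Context: Algebra. Let $m\le n$ be natural numbers. $\mathbb{A}_n^m$ is an arbitrary $n$-dimensional commutative associative algebra with unit over $\mathbb{C}$, having a basis $\{I_r\}_{r=1}^n$ with the multiplication rules (such a basis exists by a theorem of E. Cartan): (1) for $r,s\in\{1,\dots,m\}$, $I_rI_s=0$ if $r\ne s$ and $I_rI_r=I_r$; (2) for $r,s\in\{m+1,\dots,n\}$, $I_rI_s=\sum_{p=\max\{r,s\}+1}^n\Upsilon_{r,p}^{s}I_p$ with structure constants $\Upsilon_{r,p}^s\in\mathbb{C}$; (3) for every $s\in\{m+1,\dots,n\}$ there is a unique $u_s\in\{1,\dots,m\}$ such that for all $r\in\{1,\dots,m\}$, $I_rI_s=I_s$ if $r=u_s$ and $I_rI_s=0$ if $r\neq u_s$. The unit is $1=\sum_{u=1}^m I_u$. For $u=1,\dots,m$ the functional $f_u:\mathbb{A}_n^m\to\mathbb{C}$ is the $\mathbb{C}$-linear (multiplicative) functional with $f_u(I_u)=1$ and $f_u(I_r)=0$ for all $r\neq u$. The subspace $E_k$. Let $2\le k\le 2n$ and let $e_1=1,e_2,\dots,e_k\in\mathbb{A}_n^m$ be linearly independent over $\mathbb{R}$. Put $E_k=\{\zeta=\sum_{j=1}^k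 x_je_j:\ x_j\in\mathbb{R}\}$. Standing assumption: $f_u(E_k)=\mathbb{C}$ for all $u=1,\dots,m$. $E_k$ is identified with $\mathbb{R}^k$ through the coordinates $(x_1,\dots,x_k)$; all topological and metric notions for subsets of $E_k$ are those of the corresponding subsets of $\mathbb{R}^k$; for $Q\subset E_k$ the corresponding subset of $\mathbb{R}^k$ is $Q_{\mathbb{R}}$. A domain is a nonempty open connected set. Monogenic functions. A continuous function $\Phi:\Omega\to\mathbb{A}_n^m$ is monogenic in the domain $\Omega\subset E_k$ if for every $\zeta\in\Omega$ there is an element $\Phi'(\zeta)\in\mathbb{A}_n^m$ such that $\lim_{\varepsilon\to0+0}\left(\Phi(\zeta+\varepsilon h)-\Phi(\zeta)\right)\varepsilon^{-1}=h\Phi'(\zeta)$ for all $h\in E_k$. Integral. For a Jordan rectifiable curve $\gamma\subset E_k$ and a continuous $\Psi=\sum_{r=1}^n (U_r+iV_r)I_r:\gamma\to\mathbb{A}_n^m$ with real-valued functions $U_r,V_r$ of $(x_1,\dots,x_k)\in\gamma_{\mathbb{R}}$, $$\int_\gamma\Psi(\zeta)\,d\zeta:=\sum_{j=1}^k e_j\sum_{r=1}^n I_r\int_{\gamma_{\mathbb{R}}}U_r\,dx_j+i\sum_{j=1}^k e_j\sum_{r=1}^n I_r\int_{\gamma_{\mathbb{R}}}V_r\,dx_j .$$ Triangles. A triangle $\triangle$ is a plane figure in $E_k$ bounded by three line segments connecting its three vertices; $\partial\triangle$ is the boundary of $\triangle$ in the relative topology of its plane. *)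

theory Defs
  imports "HOL-Analysis.Analysis"
begin

section \<open>The algebra\<close>

text \<open>
  The type \<open>'a\<close> carries the algebra; its complex scaling, product and unit are explicit, so that
  different products on the same type are covered.  The norm of \<open>'a\<close> only supplies the
  topology: the algebras below are finite-dimensional, so every norm gives the same one.
\<close>

locale comm_complex_algebra =
  vector_space cscale + comm_monoid amul one
  for cscale :: "complex \<Rightarrow> 'a::real_normed_vector \<Rightarrow> 'a"
    and amul :: "'a \<Rightarrow> 'a \<Rightarrow> 'a"
    and one :: 'a +
  assumes cscale_of_real: "cscale (complex_of_real t) x = t *\<^sub>R x"
    and mult_add_left: "amul (x + y) z = amul x z + amul y z"
    and mult_cscale_left: "amul (cscale c x) y = cscale c (amul x y)"

text \<open>
  The multiplication rules of the Cartan basis.  In the second rule the empty sum for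
  \<open>max r s = n\<close> means \<open>I r I s = 0\<close>.
\<close>

locale cartan_algebra =
  comm_complex_algebra cscale amul one
  for cscale :: "complex \<Rightarrow> 'a::real_normed_vector \<Rightarrow> 'a"
    and amul :: "'a \<Rightarrow> 'a \<Rightarrow> 'a"
    and one :: 'a +
  fixes n m :: nat
    and I :: "nat \<Rightarrow> 'a"
  assumes m_ge_1: "1 \<le> m"
    and m_le_n: "m \<le> n"
    and basis_inj: "inj_on I {1..n}"
    and basis_independent: "module.independent cscale (I ` {1..n})"
    and basis_span: "module.span cscale (I ` {1..n}) = UNIV"
    and idempotents:
      "\<forall>r\<in>{1..m}. \<forall>s\<in>{1..m}. amul (I r) (I s) = (if r = s then I r else 0)"
    and nilpotents:
      "\<exists>\<Upsilon> :: nat \<Rightarrow> nat \<Rightarrow> nat \<Rightarrow> complex. \<forall>r\<in>{m+1..n}. \<forall>s\<in>{m+1..n}.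
        amul (I r) (I s) = (\<Sum>p = max r s + 1..n. cscale (\<Upsilon> r p s) (I p))"
    and mixed:
      "\<forall>s\<in>{m+1..n}. \<exists>!u. u \<in> {1..m} \<and>
        (\<forall>r\<in>{1..m}. amul (I r) (I s) = (if r = u then I s else 0))"

definition coord ::
  "(complex \<Rightarrow> 'a::real_normed_vector \<Rightarrow> 'a) \<Rightarrow> nat \<Rightarrow> (nat \<Rightarrow> 'a) \<Rightarrow> nat \<Rightarrow> 'a \<Rightarrow> complex" where
  "coord cscale n I r x = module.representation cscale (I ` {1..n}) x (I r)"

definition functional ::
  "(complex \<Rightarrow> 'a::real_normed_vector \<Rightarrow> 'a) \<Rightarrow> nat \<Rightarrow> (nat \<Rightarrow> 'a) \<Rightarrow> nat \<Rightarrow> 'a \<Rightarrow> complex" where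
  "functional cscale n I u = (THE f. Vector_Spaces.linear cscale (*) f \<and>
     f (I u) = 1 \<and> (\<forall>r\<in>{1..n} - {u}. f (I r) = 0))"

section \<open>The real subspace\<close>

text \<open>
  A family \<open>e\<close> indexed by a finite type \<open>'k\<close> (so that \<open>k = CARD('k)\<close>) spans \<open>E_space e\<close>;
  \<open>E_point e\<close> is the identification of the coordinate space with it, and \<open>real_coords e Q\<close> is
  the subset of coordinate space that corresponds to \<open>Q\<close>.
\<close>

definition E_point :: "('k::finite \<Rightarrow> 'a::real_normed_vector) \<Rightarrow> real ^ 'k \<Rightarrow> 'a" where
  "E_point e x = (\<Sum>j\<in>UNIV. (x $ j) *\<^sub>R e j)"

definition E_space :: "('k::finite \<Rightarrow> 'a::real_normed_vector) \<Rightarrow> 'a set" where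
  "E_space e = range (E_point e)"

definition real_coords ::
  "('k::finite \<Rightarrow> 'a::real_normed_vector) \<Rightarrow> 'a set \<Rightarrow> (real ^ 'k) set" where
  "real_coords e Q = {x. E_point e x \<in> Q}"

definition domain_in :: "('k::finite \<Rightarrow> 'a::real_normed_vector) \<Rightarrow> 'a set \<Rightarrow> bool" where
  "domain_in e \<Omega> \<longleftrightarrow> \<Omega> \<subseteq> E_space e \<and> \<Omega> \<noteq> {} \<and>
     open (real_coords e \<Omega>) \<and> connected (real_coords e \<Omega>)"

definition continuous_in ::
  "('k::finite \<Rightarrow> 'a::real_normed_vector) \<Rightarrow> 'a set \<Rightarrow> ('a \<Rightarrow> 'a) \<Rightarrow> bool" where
  "continuous_in e \<Omega> \<Phi> \<longleftrightarrow> continuous_on (real_coords e \<Omega>) (\<lambda>x. \<Phi> (E_point e x))"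

section \<open>Monogenic functions\<close>

definition monogenic_in ::
  "('a \<Rightarrow> 'a \<Rightarrow> 'a) \<Rightarrow> ('k::finite \<Rightarrow> 'a::real_normed_vector) \<Rightarrow> 'a set \<Rightarrow> ('a \<Rightarrow> 'a) \<Rightarrow> bool" where
  "monogenic_in amul e \<Omega> \<Phi> \<longleftrightarrow> continuous_in e \<Omega> \<Phi> \<and>
     (\<forall>\<zeta>\<in>\<Omega>. \<exists>d. \<forall>h\<in>E_space e.
        ((\<lambda>\<epsilon>. (1 / \<epsilon>) *\<^sub>R (\<Phi> (\<zeta> + \<epsilon> *\<^sub>R h) - \<Phi> \<zeta>)) \<longlongrightarrow> amul h d) (at_right 0))"

section \<open>Integrals along curves\<close>

text \<open>
  The integral of \<open>U\<close> with respect to the \<open>j\<close>-th coordinate.  The curve is given by a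
  parametrisation on the unit interval that is piecewise smooth or, more generally, Lipschitz
  (every rectifiable curve has one); its derivative then exists almost everywhere, and the
  points where it fails to exist do not affect the integral.
\<close>

definition line_integral ::
  "(real \<Rightarrow> real ^ 'k::finite) \<Rightarrow> (real ^ 'k \<Rightarrow> real) \<Rightarrow> 'k \<Rightarrow> real" where
  "line_integral \<gamma> U j =
     integral {0..1} (\<lambda>t. U (\<gamma> t) * (vector_derivative \<gamma> (at t within {0..1}) $ j))"

definition curve_integral ::
  "(complex \<Rightarrow> 'a::real_normed_vector \<Rightarrow> 'a) \<Rightarrow> ('a \<Rightarrow> 'a \<Rightarrow> 'a) \<Rightarrow> nat \<Rightarrow> (nat \<Rightarrow> 'a) \<Rightarrow>
   ('k::finite \<Rightarrow> 'a) \<Rightarrow> (real \<Rightarrow> real ^ 'k) \<Rightarrow> ('a \<Rightarrow> 'a) \<Rightarrow> 'a" where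
  "curve_integral cscale amul n I e \<gamma> \<Psi> =
     (\<Sum>j\<in>UNIV. amul (e j)
        (\<Sum>r=1..n. line_integral \<gamma> (\<lambda>x. Re (coord cscale n I r (\<Psi> (E_point e x)))) j *\<^sub>R I r)) +
     cscale \<i> (\<Sum>j\<in>UNIV. amul (e j)
        (\<Sum>r=1..n. line_integral \<gamma> (\<lambda>x. Im (coord cscale n I r (\<Psi> (E_point e x)))) j *\<^sub>R I r))"

definition triangle :: "real ^ 'k::finite \<Rightarrow> real ^ 'k \<Rightarrow> real ^ 'k \<Rightarrow> (real ^ 'k) set" where
  "triangle a b c = convex hull {a, b, c}"

definition triangle_path ::
  "real ^ 'k::finite \<Rightarrow> real ^ 'k \<Rightarrow> real ^ 'k \<Rightarrow> real \<Rightarrow> real ^ 'k" where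
  "triangle_path a b c = linepath a b +++ linepath b c +++ linepath c a"

section \<open>Consistency of the definitions\<close>

context cartan_algebra
begin

lemma sum_coord: "(\<Sum>r=1..n. cscale (coord cscale n I r x) (I r)) = x"
proof -
  have "(\<Sum>b\<in>I ` {1..n}. cscale (representation (I ` {1..n}) x b) b) = x"
    by (rule sum_representation_eq) (use basis_independent basis_span in auto)
  then show ?thesis
    by (simp add: sum.reindex[OF basis_inj] coord_def del: One_nat_def)
qed

lemma functional_eq_coord:
  assumes "u \<in> {1..n}"
  shows "functional cscale n I u = coord cscale n I u"
proof -
  let ?c = "coord cscale n I u"
  have lin: "Vector_Spaces.linear cscale (*) ?c"
  proof (intro Vector_Spaces.linear.intro module_hom.intro module_hom_axioms.intro
      vector_space_axioms module_axioms
      vector_space_over_itself.vector_space_axioms vector_space_over_itself.module_axioms)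
    show "?c (x + y) = ?c x + ?c y" for x y
      by (simp add: coord_def representation_add[OF basis_independent] basis_span
          del: One_nat_def)
    show "?c (cscale a x) = a * ?c x" for a x
      by (simp add: coord_def representation_scale[OF basis_independent] basis_span
          del: One_nat_def)
  qed
  have vals: "?c (I r) = (if r = u then 1 else 0)" if "r \<in> {1..n}" for r
  proof -
    have "I r = I u \<longleftrightarrow> r = u"
      using that assms basis_inj by (simp add: inj_on_eq_iff)
    moreover have "representation (I ` {1..n}) (I r) = (\<lambda>v. if v = I r then 1 else 0)"
      using that by (intro representation_basis basis_independent) blast
    ultimately show ?thesis
      by (auto simp: coord_def)
  qed
  show ?thesis
    unfolding functional_def
  proof (rule the_equality)
    show "Vector_Spaces.linear cscale (*) ?c \<and> ?c (I u) = 1 \<and> (\<forall>r\<in>{1..n} - {u}. ?c (I r) = 0)"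
      using lin vals assms by auto
  next
    fix f
    assume f: "Vector_Spaces.linear cscale (*) f \<and> f (I u) = 1 \<and> (\<forall>r\<in>{1..n} - {u}. f (I r) = 0)"
    then interpret f: Vector_Spaces.linear cscale "(*)" f by simp
    show "f = ?c"
    proof
      fix x
      have "f x = f (\<Sum>r=1..n. cscale (coord cscale n I r x) (I r))"
        by (simp only: sum_coord)
      also have "\<dots> = (\<Sum>r=1..n. coord cscale n I r x * f (I r))"
        by (simp add: f.sum f.scale)
      also have "\<dots> = (\<Sum>r=1..n. if r = u then coord cscale n I r x else 0)"
        by (rule sum.cong[OF refl]) (use f in auto)
      finally show "f x = ?c x"
        using assms by simp
    qed
  qed
qed

end

lemma path_image_triangle_path:
  assumes "\<not> collinear {a, b, c}"
  shows "path_image (triangle_path a b c) = rel_frontier (triangle a b c)"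
proof -
  have ne: "a \<noteq> b" "b \<noteq> c" "c \<noteq> a"
    using assms by (auto simp: insert_commute)
  then have "\<not> affine_dependent {a, b, c}"
    using assms by (simp add: collinear_3_eq_affine_dependent)
  then have "rel_frontier (triangle a b c) =
      \<Union> {convex hull ({a, b, c} - {x}) | x. x \<in> {a, b, c}}"
    unfolding triangle_def by (rule rel_frontier_convex_hull_cases)
  also have "\<dots> = convex hull ({a, b, c} - {a}) \<union> convex hull ({a, b, c} - {b}) \<union>
      convex hull ({a, b, c} - {c})"
    by blast
  finally have frontier: "rel_frontier (triangle a b c) =
      convex hull ({a, b, c} - {a}) \<union> convex hull ({a, b, c} - {b}) \<union>
      convex hull ({a, b, c} - {c})" .
  have "{a, b, c} - {a} = {b, c}" "{a, b, c} - {b} = {c, a}" "{a, b, c} - {c} = {a, b}"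
    using ne by auto
  then show ?thesis
    by (simp only: frontier) (simp add: triangle_path_def path_image_join segment_convex_hull Un_ac)
qed

end

theory Submission
  imports Defs
begin

text \<open>
  Write \<open>P\<close> for \<open>\<Phi>\<close> in the real coordinates.  As in the plane, the vanishing of the triangle
  integrals gives \<open>P\<close> a primitive \<open>F\<close> on each ball inside the domain: the derivative of \<open>F\<close> at
  \<open>x\<close> sends \<open>d\<close> to \<open>E d P x\<close>, where \<open>E\<close> is the map from coordinates to the algebra (lemma
  \<open>primitive\<close>).  It remains to see that the derivative \<open>P\<close> of \<open>F\<close> is itself differentiable.

  This is local in the algebra, since the unit is the sum of the idempotents \<open>I u\<close>.  Fix \<open>u\<close>.  The
  functional of \<open>u\<close> maps the real subspace onto the complex numbers, so the subspace has an element
  \<open>h\<close> on which it takes the value \<open>\<i>\<close>; then \<open>I u h = \<i> I u + \<nu>\<close> with \<open>\<nu>\<close> nilpotent (lemma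
  \<open>local_component\<close>).  In the ideal of \<open>I u\<close> the circle \<open>\<kappa> t = cos t + h sin t\<close> thus has an
  inverse \<open>w t\<close>, given by a finite geometric series in \<open>\<nu>\<close>, and the integral of \<open>\<kappa>' w\<close> over a
  period is \<open>2 \<pi> \<i> I u\<close>, because the nilpotent corrections have a periodic antiderivative (lemma
  \<open>residue\<close>).

  With this circle there is a Cauchy formula (lemma \<open>kernel_formula\<close>): \<open>2 \<pi> \<i> I u P x\<close> is
  \<open>1 / r\<close> times the integral of \<open>F (x + r \<kappa>) w\<^sup>2 \<kappa>'\<close>.  It follows from varying the radius and
  integrating by parts.  Its right-hand side contains only the differentiable function \<open>F\<close>, at
  points that move along with \<open>x\<close>.
  Differentiating in the direction \<open>d\<close> under the integral sign replaces \<open>F\<close> by \<open>E d P\<close>, so the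
  derivative of \<open>I u P\<close> is \<open>E d\<close> times an element independent of \<open>d\<close> (lemma
  \<open>component_derivative\<close>).  Summation over \<open>u\<close> gives the derivative of \<open>\<Phi>\<close>.
\<close>

section \<open>Finite-dimensional normed spaces\<close>

text \<open>
  Dividing by \<open>c\<close> turns \<open>- y / c\<close> into a point of the subspace, hence at least the infimal
  distance away from \<open>b\<close>.  This bounds a coefficient by the norm of the vector.
\<close>

lemma norm_ge_infdist_subspace:
  fixes x y b :: "'a::real_normed_vector"
  assumes "subspace S" "y \<in> S"
  shows "\<bar>c\<bar> * infdist b S \<le> norm (c *\<^sub>R b + y)"
proof (cases "c = 0")
  case False
  have "(- 1 / c) *\<^sub>R y \<in> S"
    using assms by (rule subspace_scale)
  then have "infdist b S \<le> dist b ((- 1 / c) *\<^sub>R y)"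
    by (rule infdist_le)
  then have "\<bar>c\<bar> * infdist b S \<le> \<bar>c\<bar> * norm (b + (1 / c) *\<^sub>R y)"
    by (simp add: dist_norm mult_left_mono)
  also have "\<dots> = norm (c *\<^sub>R (b + (1 / c) *\<^sub>R y))"
    by simp
  finally show ?thesis
    using False by (simp add: scaleR_add_right)
qed simp

text \<open>
  Adding one vector \<open>b\<close> outside a closed span keeps it closed: along a convergent sequence the
  \<open>b\<close>-coefficients form a Cauchy sequence by the previous bound, so the remainders converge too.
\<close>

lemma closed_span_finite:
  fixes B :: "'a::real_normed_vector set"
  assumes "finite B"
  shows "closed (span B)"
  using assms
proof (induction B rule: finite_induct)
  case empty
  then show ?case by simp
next
  case (insert b B)
  show ?case
  proof (cases "b \<in> span B")
    case True
    then show ?thesis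
      using insert.IH by (simp add: span_redundant)
  next
    case False
    define d where "d = infdist b (span B)"
    have d: "d > 0"
      unfolding d_def using insert.IH False span_zero by (intro infdist_pos_not_in_closed) auto
    show ?thesis
      unfolding closed_sequential_limits
    proof (intro allI impI)
      fix x l
      assume "(\<forall>k::nat. x k \<in> span (insert b B)) \<and> x \<longlonglongrightarrow> l"
      then have x: "\<And>k. x k \<in> span (insert b B)" and lim: "x \<longlonglongrightarrow> l" by auto
      then have "\<forall>k. \<exists>c. x k - c *\<^sub>R b \<in> span B"
        by (simp add: span_breakdown_eq)
      then obtain c where c: "\<And>k. x k - c k *\<^sub>R b \<in> span B" by metis
      have bound: "dist (c i) (c j) \<le> dist (x i) (x j) / d" for i j
      proof -
        have "(x i - c i *\<^sub>R b) - (x j - c j *\<^sub>R b) \<in> span B"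
          using span_diff[OF c c] .
        from norm_ge_infdist_subspace[OF subspace_span this, of "c i - c j" b]
        show ?thesis
          using d by (simp add: d_def dist_norm field_simps scaleR_diff_left)
      qed
      have "Cauchy c"
      proof (rule metric_CauchyI)
        fix \<epsilon> :: real assume "\<epsilon> > 0"
        then obtain M where M: "\<And>i j. i \<ge> M \<Longrightarrow> j \<ge> M \<Longrightarrow> dist (x i) (x j) < \<epsilon> * d"
          using metric_CauchyD[OF LIMSEQ_imp_Cauchy[OF lim], of "\<epsilon> * d"] d by auto
        have "dist (c i) (c j) < \<epsilon>" if "i \<ge> M" "j \<ge> M" for i j
          using order_le_less_trans[OF bound, of i j \<epsilon>] M[OF that] d
          by (simp add: pos_divide_less_eq)
        then show "\<exists>M. \<forall>i\<ge>M. \<forall>j\<ge>M. dist (c i) (c j) < \<epsilon>" by blast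
      qed
      then obtain c0 where "c \<longlonglongrightarrow> c0"
        using Cauchy_convergent convergent_def by blast
      then have "(\<lambda>k. x k - c k *\<^sub>R b) \<longlonglongrightarrow> l - c0 *\<^sub>R b"
        using lim by (intro tendsto_intros)
      then have "l - c0 *\<^sub>R b \<in> span B"
        by (rule closed_sequentially[OF insert.IH c])
      then show "l \<in> span (insert b B)"
        by (auto simp: span_breakdown_eq)
    qed
  qed
qed

text \<open>
  A finite-dimensional real normed space, presented by a basis whose coordinate functionals are
  bounded.  The type class of normed spaces carries no completeness, so integration of vector-valued
  functions is reduced to their real coordinates.
\<close>

locale bounded_coordinates =
  fixes D :: "'a::real_normed_vector set" and p :: "'a \<Rightarrow> 'a \<Rightarrow> real"
  assumes finite_basis: "finite D"
    and bounded_coordinate: "\<And>b. b \<in> D \<Longrightarrow> bounded_linear (p b)"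
    and expansion: "\<And>x. (\<Sum>b\<in>D. p b x *\<^sub>R b) = x"

text \<open>
  The distance from a basis vector to the span of the others is positive because that span is
  closed; its reciprocal bounds the coordinate functional.
\<close>

lemma bounded_coordinates_exist:
  fixes B :: "'a::real_normed_vector set"
  assumes finite_gens: "finite B" and span_gens: "span B = UNIV"
  shows "\<exists>(D :: 'a set) p. bounded_coordinates D p"
proof -
  obtain D where D: "D \<subseteq> B" "independent D" "B \<subseteq> span D"
    using maximal_independent_subset[of B] by metis
  have fin: "finite D"
    using D(1) finite_gens finite_subset by blast
  have spanD: "span D = UNIV"
    using D(3) span_gens span_minimal subspace_span by (metis top.extremum_uniqueI)
  define p where "p = (\<lambda>b x. representation D x b)"
  have expand: "(\<Sum>b\<in>D. p b x *\<^sub>R b) = x" for x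
    unfolding p_def by (rule real_vector.sum_representation_eq) (use D fin spanD in auto)
  have "bounded_linear (p b)" if b: "b \<in> D" for b
  proof -
    define d where "d = infdist b (span (D - {b}))"
    have "b \<notin> span (D - {b})"
      using D(2) b by (auto simp: dependent_def)
    then have d: "d > 0"
      unfolding d_def using span_zero fin
      by (intro infdist_pos_not_in_closed closed_span_finite) auto
    show ?thesis
    proof (rule bounded_linear_intro[where K = "1 / d"])
      show "p b (x + y) = p b x + p b y" for x y
        unfolding p_def using D spanD by (simp add: real_vector.representation_add)
      show "p b (r *\<^sub>R x) = r *\<^sub>R p b x" for r x
        unfolding p_def using D spanD by (simp add: real_vector.representation_scale)
      show "norm (p b x) \<le> norm x * (1 / d)" for x
      proof -
        have "(\<Sum>v\<in>D - {b}. p v x *\<^sub>R v) \<in> span (D - {b})"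
          by (intro span_sum span_scale span_base)
        from norm_ge_infdist_subspace[OF subspace_span this, of "p b x" b]
        have "\<bar>p b x\<bar> * d \<le> norm x"
          using expand[of x] by (simp add: sum.remove[OF fin b] d_def)
        then show ?thesis
          using d by (simp add: field_simps)
      qed
    qed
  qed
  then have "bounded_coordinates D p"
    using fin expand by (intro bounded_coordinates.intro) auto
  then show ?thesis by blast
qed

context bounded_coordinates
begin

lemma linear_bounded:
  fixes f :: "'a \<Rightarrow> 'b::real_normed_vector"
  assumes "linear f"
  shows "bounded_linear f"
proof -
  have "f = (\<lambda>x. \<Sum>b\<in>D. p b x *\<^sub>R f b)"
  proof
    fix x
    have "f x = f (\<Sum>b\<in>D. p b x *\<^sub>R b)" by (simp only: expansion)
    then show "f x = (\<Sum>b\<in>D. p b x *\<^sub>R f b)"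
      using assms by (simp add: linear_sum linear_scale)
  qed
  moreover have "bounded_linear (\<lambda>x. \<Sum>b\<in>D. p b x *\<^sub>R f b)"
    by (intro bounded_linear_sum bounded_linear_scaleR_const bounded_coordinate)
  ultimately show ?thesis by simp
qed

lemma bilinear_bounded:
  fixes f :: "'a \<Rightarrow> 'a \<Rightarrow> 'b::real_normed_vector"
  assumes left: "\<And>x. linear (\<lambda>y. f y x)" and right: "\<And>x. linear (f x)"
  shows "bounded_bilinear f"
proof -
  have bl: "bounded_linear (f b)" for b
    using linear_bounded right by blast
  obtain K where K: "\<And>b x. b \<in> D \<Longrightarrow> norm (p b x) \<le> norm x * K b"
    using bounded_linear.bounded[OF bounded_coordinate] by metis
  obtain L where L: "\<And>b x. norm (f b x) \<le> norm x * L b"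
    using bounded_linear.bounded[OF bl] by metis
  have expand: "f x y = (\<Sum>b\<in>D. p b x *\<^sub>R f b y)" for x y
  proof -
    have "f x y = f (\<Sum>b\<in>D. p b x *\<^sub>R b) y" by (simp only: expansion)
    also have "\<dots> = (\<Sum>b\<in>D. p b x *\<^sub>R f b y)"
      by (simp only: linear_sum[OF left] linear_scale[OF left])
    finally show ?thesis .
  qed
  show ?thesis
  proof
    show "f (a + a') b = f a b + f a' b" "f a (b + b') = f a b + f a b'"
      "f (r *\<^sub>R a) b = r *\<^sub>R f a b" "f a (r *\<^sub>R b) = r *\<^sub>R f a b" for a a' b b' r
      using linear_add[OF left] linear_add[OF right] linear_scale[OF left] linear_scale[OF right]
      by auto
    have "norm (f x y) \<le> norm x * norm y * (\<Sum>b\<in>D. K b * L b)" for x y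
    proof -
      have "norm (f x y) \<le> (\<Sum>b\<in>D. norm (p b x) * norm (f b y))"
        by (subst expand, rule order_trans[OF norm_sum]) simp
      also have "\<dots> \<le> (\<Sum>b\<in>D. (norm x * K b) * (norm y * L b))"
        using order_trans[OF norm_ge_zero K] L by (intro sum_mono mult_mono K) simp_all
      finally show ?thesis
        by (simp add: sum_distrib_left algebra_simps)
    qed
    then show "\<exists>K. \<forall>a b. norm (f a b) \<le> norm a * norm b * K" by blast
  qed
qed

lemma has_integral_componentwise:
  assumes f: "\<And>b. b \<in> D \<Longrightarrow> ((\<lambda>t. p b (f t)) has_integral p b i) S"
  shows "(f has_integral (i::'a)) (S :: real set)"
proof -
  have "((\<lambda>t. \<Sum>b\<in>D. p b (f t) *\<^sub>R b) has_integral (\<Sum>b\<in>D. p b i *\<^sub>R b)) S"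
    using has_integral_linear[OF f bounded_linear_scaleR_left] finite_basis
    by (intro has_integral_sum) (auto simp: o_def)
  then show ?thesis by (simp add: expansion)
qed

lemma fundamental_theorem:
  fixes f :: "real \<Rightarrow> 'a"
  assumes "a \<le> b"
    and f: "\<And>t. t \<in> {a..b} \<Longrightarrow> (f has_vector_derivative f' t) (at t within {a..b})"
  shows "(f' has_integral (f b - f a)) {a..b}"
proof -
  show ?thesis
  proof (rule has_integral_componentwise)
    fix b' assume b': "b' \<in> D"
    interpret bounded_linear "p b'" by (rule bounded_coordinate[OF b'])
    show "((\<lambda>t. p b' (f' t)) has_integral p b' (f b - f a)) {a..b}"
      unfolding diff using assms has_vector_derivative
      by (intro fundamental_theorem_of_calculus) auto
  qed
qed

lemma continuous_integrable:
  fixes f :: "real \<Rightarrow> 'a"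
  assumes "continuous_on {a..b} f"
  shows "f integrable_on {a..b}"
proof -
  have "(\<lambda>t. p d (f t)) integrable_on {a..b}" if "d \<in> D" for d
    using bounded_linear.continuous_on[OF bounded_coordinate[OF that] assms]
    by (rule integrable_continuous_interval)
  then have "(\<lambda>t. \<Sum>d\<in>D. p d (f t) *\<^sub>R d) integrable_on {a..b}"
    using finite_basis integrable_linear[OF _ bounded_linear_scaleR_left]
    by (intro integrable_sum) (auto simp: o_def)
  then show ?thesis by (simp add: expansion)
qed

lemma continuous_has_integral:
  fixes f :: "real \<Rightarrow> 'a"
  assumes "continuous_on {a..b} f"
  shows "(f has_integral integral {a..b} f) {a..b}"
  using continuous_integrable[OF assms] by (rule integrable_integral)

lemma integral_by_components:
  assumes f: "continuous_on {a..b} (f :: real \<Rightarrow> 'a)"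
  shows "integral {a..b} f = (\<Sum>d\<in>D. integral {a..b} (\<lambda>t. p d (f t)) *\<^sub>R d)"
proof -
  have "integral {a..b} (p d \<circ> f) = p d (integral {a..b} f)" if "d \<in> D" for d
    by (rule integral_linear[OF continuous_integrable[OF f] bounded_coordinate[OF that]])
  then show ?thesis by (simp add: o_def expansion)
qed

lemma antiderivative:
  fixes f :: "real \<Rightarrow> 'a"
  assumes "continuous_on {a..b} f"
  obtains g where
    "\<And>t. t \<in> {a..b} \<Longrightarrow> (g has_vector_derivative f t) (at t within {a..b})"
proof -
  have "\<exists>g. \<forall>t\<in>{a..b}. (g has_vector_derivative p d (f t)) (at t within {a..b})" if "d \<in> D" for d
    by (rule antiderivative_continuous[OF bounded_linear.continuous_on[OF bounded_coordinate[OF that] assms]]) blast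
  then obtain g where g: "\<And>d t. d \<in> D \<Longrightarrow> t \<in> {a..b} \<Longrightarrow>
      (g d has_vector_derivative p d (f t)) (at t within {a..b})" by metis
  have "((\<lambda>t. \<Sum>d\<in>D. g d t *\<^sub>R d) has_vector_derivative f t) (at t within {a..b})"
    if "t \<in> {a..b}" for t
  proof -
    have "((\<lambda>t. \<Sum>d\<in>D. g d t *\<^sub>R d) has_vector_derivative (\<Sum>d\<in>D. p d (f t) *\<^sub>R d))
        (at t within {a..b})"
      by (intro has_vector_derivative_sum g that
          bounded_linear.has_vector_derivative[OF bounded_linear_scaleR_left])
    then show ?thesis by (simp only: expansion)
  qed
  then show thesis by (rule that)
qed

lemma continuous_parametric_integral:
  fixes f :: "'x::topological_space \<Rightarrow> real \<Rightarrow> 'a"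
  assumes cont: "continuous_on (U \<times> {a..b}) (\<lambda>(x, t). f x t)"
  shows "continuous_on U (\<lambda>x. integral {a..b} (f x))"
proof -
  have slice: "continuous_on {a..b} (f x)" if "x \<in> U" for x
  proof -
    have "continuous_on {a..b} (Pair x)"
      by (rule continuous_on_Pair[OF continuous_on_const continuous_on_id])
    then show ?thesis
      using continuous_on_compose2[OF cont, of "{a..b}" "Pair x"] that by auto
  qed
  have "continuous_on U (\<lambda>x. integral (cbox a b) (\<lambda>t. p d (f x t)))" if "d \<in> D" for d
    by (rule integral_continuous_on_param)
      (use bounded_linear.continuous_on[OF bounded_coordinate[OF that] cont] in \<open>simp add: case_prod_unfold\<close>)
  then have "continuous_on U (\<lambda>x. \<Sum>d\<in>D. integral {a..b} (\<lambda>t. p d (f x t)) *\<^sub>R d)"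
    by (intro continuous_intros) auto
  then show ?thesis
    by (rule continuous_on_eq) (use integral_by_components[OF slice] in auto)
qed

lemma derivative_under_integral:
  fixes f :: "real \<Rightarrow> real \<Rightarrow> 'a"
  assumes deriv: "\<And>s t. s \<in> U \<Longrightarrow> t \<in> {a..b} \<Longrightarrow>
      ((\<lambda>s. f s t) has_vector_derivative f' s t) (at s within U)"
    and slice: "\<And>s. s \<in> U \<Longrightarrow> continuous_on {a..b} (f s)"
    and cont: "continuous_on (U \<times> {a..b}) (\<lambda>(s, t). f' s t)"
    and U: "s0 \<in> U" "convex U"
  shows "((\<lambda>s. integral {a..b} (f s)) has_vector_derivative integral {a..b} (f' s0)) (at s0 within U)"
proof -
  have slice': "continuous_on {a..b} (f' s)" if "s \<in> U" for s
  proof -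
    have "continuous_on {a..b} (Pair s)"
      by (rule continuous_on_Pair[OF continuous_on_const continuous_on_id])
    then show ?thesis
      using continuous_on_compose2[OF cont, of "{a..b}" "Pair s"] that by auto
  qed
  have "((\<lambda>s. integral (cbox a b) (\<lambda>t. p d (f s t))) has_vector_derivative
      integral (cbox a b) (\<lambda>t. p d (f' s0 t))) (at s0 within U)" if d: "d \<in> D" for d
  proof (rule leibniz_rule_vector_derivative[OF _ _ _ U])
    show "((\<lambda>s. p d (f s t)) has_vector_derivative p d (f' s t)) (at s within U)"
      if "s \<in> U" "t \<in> cbox a b" for s t
      using bounded_linear.has_vector_derivative[OF bounded_coordinate[OF d] deriv] that by simp
    show "(\<lambda>t. p d (f s t)) integrable_on cbox a b" if "s \<in> U" for s
      using bounded_linear.continuous_on[OF bounded_coordinate[OF d] slice[OF that]]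
      by (simp add: integrable_continuous_interval)
    show "continuous_on (U \<times> cbox a b) (\<lambda>(s, t). p d (f' s t))"
      using bounded_linear.continuous_on[OF bounded_coordinate[OF d] cont] by (simp add: case_prod_unfold)
  qed
  then have "((\<lambda>s. \<Sum>d\<in>D. integral {a..b} (\<lambda>t. p d (f s t)) *\<^sub>R d) has_vector_derivative
      (\<Sum>d\<in>D. integral {a..b} (\<lambda>t. p d (f' s0 t)) *\<^sub>R d)) (at s0 within U)"
    by (intro has_vector_derivative_sum
        bounded_linear.has_vector_derivative[OF bounded_linear_scaleR_left]) simp
  then show ?thesis
    unfolding integral_by_components[OF slice'[OF U(1)]]
    by (rule has_vector_derivative_transform[OF U(1), rotated])
      (use integral_by_components[OF slice] in auto)
qed

end

section \<open>Algebraic structure\<close>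

context comm_complex_algebra
begin

lemma mult_add_right: "amul x (y + z) = amul x y + amul x z"
  by (simp add: commute[of x] mult_add_left)

lemma mult_cscale_right: "amul x (cscale c y) = cscale c (amul x y)"
  by (simp add: commute[of x] mult_cscale_left)

lemma mult_scaleR_left: "amul (t *\<^sub>R x) y = t *\<^sub>R amul x y"
  by (simp flip: cscale_of_real add: mult_cscale_left)

lemma mult_scaleR_right: "amul x (t *\<^sub>R y) = t *\<^sub>R amul x y"
  by (simp flip: cscale_of_real add: mult_cscale_right)

lemma linear_mult_left: "linear (\<lambda>x. amul x y)"
  by (intro linearI mult_add_left mult_scaleR_left)

lemma linear_mult_right: "linear (amul x)"
  by (intro linearI mult_add_right mult_scaleR_right)

lemma cscale_decomp: "cscale c x = Re c *\<^sub>R x + Im c *\<^sub>R cscale \<i> x"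
proof -
  have "cscale c x = cscale (of_real (Re c) + of_real (Im c) * \<i>) x"
    by (simp add: complex_eq mult.commute)
  also have "\<dots> = Re c *\<^sub>R x + Im c *\<^sub>R cscale \<i> x"
    by (simp only: scale_left_distrib cscale_of_real flip: scale_scale)
  finally show ?thesis .
qed

lemma linear_cscale_right: "linear (cscale c)"
proof (rule linearI)
  show "cscale c (t *\<^sub>R x) = t *\<^sub>R cscale c x" for t x
  proof -
    have "cscale c (cscale (of_real t) x) = cscale (of_real t) (cscale c x)"
      by (rule scale_left_commute)
    then show ?thesis by (simp only: cscale_of_real)
  qed
qed (rule scale_right_distrib)

lemma bounded_linear_cscale_left: "bounded_linear (\<lambda>c. cscale c x)"
proof -
  have "bounded_linear (\<lambda>c. Re c *\<^sub>R x + Im c *\<^sub>R cscale \<i> x)"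
    by (intro bounded_linear_add bounded_linear_scaleR_const bounded_linear_Re bounded_linear_Im)
  then show ?thesis by (simp only: cscale_decomp[symmetric])
qed

lemma mult_span:
  assumes gens: "\<And>a b. a \<in> A \<Longrightarrow> b \<in> B \<Longrightarrow> amul a b \<in> span C"
    and "x \<in> span A" "y \<in> span B"
  shows "amul x y \<in> span C"
proof -
  have gen_left: "amul a y \<in> span C" if a: "a \<in> A" for a
    using \<open>y \<in> span B\<close>
  proof (induction rule: span_induct_alt)
    case base
    show ?case using linear_0[OF linear_mult_right, of a] by (simp add: span_zero)
  next
    case (step c b z)
    then show ?case
      using gens[OF a] by (simp add: mult_add_right mult_cscale_right span_add span_scale)
  qed
  show ?thesis
    using \<open>x \<in> span A\<close>
  proof (induction rule: span_induct_alt)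
    case base
    show ?case using linear_0[OF linear_mult_left, of y] by (simp add: span_zero)
  next
    case (step c a z)
    then show ?case
      using gen_left by (simp add: mult_add_left mult_cscale_left span_add span_scale)
  qed
qed

end

context cartan_algebra
begin

text \<open>
  Finitely many real generators make the algebra a finite-dimensional real normed space, so that
  its product and its coordinates are continuous for whichever norm the type carries.
\<close>

lemma basis_real_span:
  "real_vector.span (I ` {1..n} \<union> (\<lambda>r. cscale \<i> (I r)) ` {1..n}) = UNIV" (is "?S = UNIV")
proof -
  have "x \<in> ?S" for x
  proof -
    have "cscale (coord cscale n I r x) (I r) \<in> ?S" if "r \<in> {1..n}" for r
      unfolding cscale_decomp[of "coord cscale n I r x"] using that
      by (intro real_vector.span_add real_vector.span_scale real_vector.span_base) auto
    then have "(\<Sum>r=1..n. cscale (coord cscale n I r x) (I r)) \<in> ?S"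
      by (rule real_vector.span_sum)
    then show ?thesis by (simp only: sum_coord)
  qed
  then show ?thesis by blast
qed

lemma linear_coord: "linear (coord cscale n I r)"
proof (rule linearI)
  show "coord cscale n I r (x + y) = coord cscale n I r x + coord cscale n I r y" for x y
    by (simp add: coord_def representation_add[OF basis_independent] basis_span del: One_nat_def)
  show "coord cscale n I r (t *\<^sub>R x) = t *\<^sub>R coord cscale n I r x" for t x
    by (simp flip: cscale_of_real add: coord_def representation_scale[OF basis_independent]
        basis_span scaleR_conv_of_real del: One_nat_def)
qed

lemma mult_basis_nilpotent:
  assumes "u \<in> {1..m}" "s \<in> {m+1..n}"
  shows "amul (I u) (I s) = I s \<or> amul (I u) (I s) = 0"
  using mixed assms by metis

text \<open>
  The sum of the idempotents fixes every basis vector: an idempotent is hit by itself alone, and a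
  nilpotent basis vector by its unique partner alone.  So the sum is a unit element.
\<close>

lemma one_eq_sum_idempotents: "one = (\<Sum>u=1..m. I u)"
proof -
  let ?e = "\<Sum>u=1..m. I u"
  have mult: "amul ?e x = (\<Sum>u=1..m. amul (I u) x)" for x
    by (rule linear_sum[OF linear_mult_left])
  have basis: "amul ?e (I r) = I r" if r: "r \<in> {1..n}" for r
  proof (cases "r \<le> m")
    case True
    have "(\<Sum>u=1..m. amul (I u) (I r)) = (\<Sum>u=1..m. if u = r then I r else 0)"
      using True r idempotents by (intro sum.cong) auto
    then show ?thesis
      using True r by (simp add: mult del: One_nat_def)
  next
    case False
    then obtain v where v: "v \<in> {1..m}"
      "\<forall>u\<in>{1..m}. amul (I u) (I r) = (if u = v then I r else 0)"
      using mixed r by (metis Suc_eq_plus1 Suc_leI atLeastAtMost_iff linorder_not_le)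
    then have "(\<Sum>u=1..m. amul (I u) (I r)) = (\<Sum>u=1..m. if u = v then I r else 0)"
      by (intro sum.cong) auto
    then show ?thesis
      using v by (simp add: mult del: One_nat_def)
  qed
  have "one = (\<Sum>r=1..n. cscale (coord cscale n I r one) (I r))"
    by (simp only: sum_coord)
  also have "\<dots> = (\<Sum>r=1..n. amul ?e (cscale (coord cscale n I r one) (I r)))"
    using basis by (intro sum.cong) (simp_all add: mult_cscale_right)
  also have "\<dots> = amul ?e one"
    by (simp only: sum_coord flip: linear_sum[OF linear_mult_right])
  finally show ?thesis
    by (simp only: right_neutral)
qed

text \<open>
  The products of two nilpotent basis vectors involve only later ones, so multiplication by an
  element of the radical moves up the filtration by the spans of the tails of the basis; this makes
  the radical nilpotent.
\<close>

lemma mult_radical_filtration: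
  assumes "x \<in> span (I ` {m+1..n})" "y \<in> span (I ` {q..n})" "m + 1 \<le> q"
  shows "amul x y \<in> span (I ` {q+1..n})"
proof (rule mult_span[OF _ assms(1,2)])
  fix a b assume "a \<in> I ` {m+1..n}" "b \<in> I ` {q..n}"
  then obtain r s where rs: "a = I r" "b = I s" "r \<in> {m+1..n}" "s \<in> {q..n}" by blast
  obtain \<Upsilon> :: "nat \<Rightarrow> nat \<Rightarrow> nat \<Rightarrow> complex" where
    \<Upsilon>: "\<forall>r\<in>{m+1..n}. \<forall>s\<in>{m+1..n}.
        amul (I r) (I s) = (\<Sum>p = max r s + 1..n. cscale (\<Upsilon> r p s) (I p))"
    using nilpotents by blast
  have "s \<in> {m+1..n}"
    using rs assms(3) by auto
  then have "amul a b = (\<Sum>p = max r s + 1..n. cscale (\<Upsilon> r p s) (I p))"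
    using \<Upsilon> rs by blast
  also have "\<dots> \<in> span (I ` {q+1..n})"
    using rs by (intro span_sum span_scale span_base imageI) auto
  finally show "amul a b \<in> span (I ` {q+1..n})" .
qed

text \<open>
  Multiplication by \<open>I u\<close> annihilates the other idempotents and keeps or annihilates each later
  basis vector.  What remains besides the scalar part lies in the radical, and its powers move up
  the filtration until the basis is exhausted.
\<close>

lemma local_component:
  assumes u: "u \<in> {1..m}"
  obtains \<nu> where "amul (I u) x = cscale (coord cscale n I u x) (I u) + \<nu>"
    "amul (I u) \<nu> = \<nu>" "(amul \<nu> ^^ Suc (n - m)) (I u) = 0"
proof -
  let ?c = "coord cscale n I u x"
  define \<nu> where "\<nu> = amul (I u) x - cscale ?c (I u)"
  have idem: "amul (I u) (I u) = I u"
    using idempotents u by simp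
  have dec: "amul (I u) x = cscale ?c (I u) + \<nu>"
    by (simp add: \<nu>_def)
  have "amul (I u) \<nu> = amul (I u) (amul (I u) x) - amul (I u) (cscale ?c (I u))"
    unfolding \<nu>_def by (rule linear_diff[OF linear_mult_right])
  then have fix_nu: "amul (I u) \<nu> = \<nu>"
    by (simp add: \<nu>_def mult_cscale_right idem flip: assoc)
  have un: "u \<in> {1..n}"
    using u m_le_n by auto
  have "amul (I u) x = amul (I u) (\<Sum>r=1..n. cscale (coord cscale n I r x) (I r))"
    by (simp only: sum_coord)
  also have "\<dots> = (\<Sum>r=1..n. cscale (coord cscale n I r x) (amul (I u) (I r)))"
    by (simp only: linear_sum[OF linear_mult_right] mult_cscale_right)
  also have "\<dots> = cscale ?c (I u) + (\<Sum>r\<in>{1..n} - {u}. cscale (coord cscale n I r x) (amul (I u) (I r)))"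
    using un by (simp add: sum.remove[of _ u] idem)
  finally have nu: "\<nu> = (\<Sum>r\<in>{1..n} - {u}. cscale (coord cscale n I r x) (amul (I u) (I r)))"
    by (simp add: \<nu>_def)
  have "amul (I u) (I r) \<in> span (I ` {m+1..n})" if r: "r \<in> {1..n} - {u}" for r
  proof (cases "r \<le> m")
    case True
    then have "amul (I u) (I r) = 0"
      using r u idempotents by auto
    then show ?thesis by (simp add: span_zero)
  next
    case False
    then have "r \<in> {m+1..n}" using r by auto
    with mult_basis_nilpotent[OF u this] show ?thesis
      by (auto intro: span_base span_zero)
  qed
  then have nil: "\<nu> \<in> span (I ` {m+1..n})"
    unfolding nu by (intro span_sum span_scale)
  have pow: "(amul \<nu> ^^ Suc j) (I u) \<in> span (I ` {m+1+j..n})" for j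
  proof (induction j)
    case 0
    show ?case using nil fix_nu by (simp add: commute[of \<nu>])
  next
    case (Suc j)
    have "amul \<nu> ((amul \<nu> ^^ Suc j) (I u)) \<in> span (I ` {m+1+j+1..n})"
      by (rule mult_radical_filtration[OF nil Suc.IH]) simp
    then show ?case by simp
  qed
  have "m + 1 + (n - m) = n + 1"
    using m_le_n by simp
  then have "(amul \<nu> ^^ Suc (n - m)) (I u) = 0"
    using pow[of "n - m"] by simp
  with dec fix_nu show thesis by (rule that)
qed

end

locale finite_dim_algebra =
  comm_complex_algebra cscale amul one + bounded_coordinates D p
  for cscale :: "complex \<Rightarrow> 'a::real_normed_vector \<Rightarrow> 'a"
    and amul :: "'a \<Rightarrow> 'a \<Rightarrow> 'a"
    and one :: 'a
    and D :: "'a set" and p :: "'a \<Rightarrow> 'a \<Rightarrow> real"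
begin

lemma bounded_bilinear_mult: "bounded_bilinear amul"
  by (intro bilinear_bounded linear_mult_left linear_mult_right)

lemmas bounded_linear_mult_left = bounded_bilinear.bounded_linear_left[OF bounded_bilinear_mult]
lemmas bounded_linear_mult_right = bounded_bilinear.bounded_linear_right[OF bounded_bilinear_mult]
lemmas continuous_on_mult = bounded_bilinear.continuous_on[OF bounded_bilinear_mult]
lemmas has_vector_derivative_cscale =
  bounded_linear.has_vector_derivative[OF bounded_linear_cscale_left]
lemmas bounded_linear_cscale_right = linear_bounded[OF linear_cscale_right]

end

section \<open>A Cauchy formula in one local component\<close>

text \<open>
  The situation in the ideal generated by an idempotent \<open>e0\<close> when the direction \<open>h\<close> has the
  scalar part \<open>\<i>\<close> there.  In this ideal the plane of \<open>one\<close> and \<open>h\<close> is a complex line up to the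
  nilpotent \<open>\<nu>\<close>, and its unit circle consists of invertible elements.
\<close>

locale elliptic_direction = finite_dim_algebra cscale amul one D p
  for cscale :: "complex \<Rightarrow> 'a::real_normed_vector \<Rightarrow> 'a"
    and amul :: "'a \<Rightarrow> 'a \<Rightarrow> 'a"
    and one :: 'a
    and D :: "'a set" and p :: "'a \<Rightarrow> 'a \<Rightarrow> real" +
  fixes e0 h \<nu> :: 'a and N :: nat
  assumes idem: "amul e0 e0 = e0"
    and h_component: "amul e0 h = cscale \<i> e0 + \<nu>"
    and nu_component: "amul e0 \<nu> = \<nu>"
    and nilpotent: "(amul \<nu> ^^ N) e0 = 0"
begin

text \<open>
  The unit circle of the plane of \<open>one\<close> and \<open>h\<close>: modulo the nilpotent \<open>\<nu>\<close> its component in the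
  ideal of \<open>e0\<close> is \<open>cis t\<close> times \<open>e0\<close>.  Its velocity is \<open>\<kappa>'\<close>.
\<close>

definition \<kappa> :: "real \<Rightarrow> 'a" where
  "\<kappa> t = cos t *\<^sub>R one + sin t *\<^sub>R h"

definition \<kappa>' :: "real \<Rightarrow> 'a" where
  "\<kappa>' t = - sin t *\<^sub>R one + cos t *\<^sub>R h"

text \<open>
  Multiplied by \<open>e0\<close>, the circle is \<open>cis t\<close> times \<open>e0 + q t \<nu>\<close>; the function \<open>q'\<close> is
  the derivative of \<open>q\<close>.
\<close>

definition q :: "real \<Rightarrow> complex" where
  "q t = cis (- t) * of_real (sin t)"

definition q' :: "real \<Rightarrow> complex" where
  "q' t = cis (- t) * of_real (cos t) - \<i> * q t"

text \<open>
  The inverse of \<open>e0 + q t \<nu>\<close> as a geometric series, which is finite since \<open>\<nu>\<close> is nilpotent;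
  then \<open>w\<close> is the inverse of the circle relative to \<open>e0\<close>.
\<close>

definition geometric_sum :: "real \<Rightarrow> 'a" where
  "geometric_sum t = (\<Sum>j<N. cscale ((- q t) ^ j) ((amul \<nu> ^^ j) e0))"

definition w :: "real \<Rightarrow> 'a" where
  "w t = cscale (cis (- t)) (geometric_sum t)"

lemma e0_mult_power: "amul e0 ((amul \<nu> ^^ j) e0) = (amul \<nu> ^^ j) e0"
  by (induction j) (simp_all add: idem left_commute[of e0])

lemma e0_mult_geom: "amul e0 (geometric_sum t) = geometric_sum t"
  by (simp add: geometric_sum_def linear_sum[OF linear_mult_right] mult_cscale_right e0_mult_power)

lemma e0_mult_w: "amul e0 (w t) = w t"
  by (simp add: w_def mult_cscale_right e0_mult_geom)

lemma nu_mult_geom: "amul \<nu> (geometric_sum t) = (\<Sum>j<N. cscale ((- q t) ^ j) ((amul \<nu> ^^ Suc j) e0))"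
  by (simp add: geometric_sum_def linear_sum[OF linear_mult_right] mult_cscale_right)

lemma geom_inverse: "geometric_sum t + cscale (q t) (amul \<nu> (geometric_sum t)) = e0"
proof -
  let ?T = "\<lambda>j. cscale ((- q t) ^ j) ((amul \<nu> ^^ j) e0)"
  have "cscale (q t) (amul \<nu> (geometric_sum t)) = (\<Sum>j<N. - ?T (Suc j))"
    unfolding nu_mult_geom linear_sum[OF linear_cscale_right] by (intro sum.cong) simp_all
  then have "geometric_sum t + cscale (q t) (amul \<nu> (geometric_sum t)) = (\<Sum>j<N. ?T j - ?T (Suc j))"
    by (simp add: geometric_sum_def sum.distrib sum_subtractf sum_negf)
  also have "\<dots> = ?T 0 - ?T N"
    by (rule sum_lessThan_telescope')
  finally show ?thesis
    by (simp add: nilpotent)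
qed

lemma kappa_component: "amul (\<kappa> t) e0 = cscale (cis t) (e0 + cscale (q t) \<nu>)"
proof -
  have "amul (\<kappa> t) e0 = cos t *\<^sub>R e0 + sin t *\<^sub>R (cscale \<i> e0 + \<nu>)"
    by (simp add: \<kappa>_def mult_add_left mult_scaleR_left commute[of h] h_component)
  also have "\<dots> = cscale (of_real (cos t) + of_real (sin t) * \<i>) e0 + cscale (of_real (sin t)) \<nu>"
    by (simp add: cscale_of_real scale_left_distrib scaleR_add_right flip: scale_scale)
  also have "of_real (cos t) + of_real (sin t) * \<i> = cis t"
    by (simp add: complex_eq_iff)
  also have "of_real (sin t) = cis t * q t"
    by (simp add: q_def cis_mult flip: mult.assoc)
  finally show ?thesis
    by (simp add: scale_right_distrib)
qed

lemma kappa'_component: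
  "amul (\<kappa>' t) e0 = cscale (cis t) (cscale \<i> e0 + cscale (cis (- t) * of_real (cos t)) \<nu>)"
proof -
  have "amul (\<kappa>' t) e0 = - sin t *\<^sub>R e0 + cos t *\<^sub>R (cscale \<i> e0 + \<nu>)"
    unfolding \<kappa>'_def
    by (simp add: mult_add_left mult_scaleR_left commute[of h] h_component
        linear_neg[OF linear_mult_left] del: scaleR_minus_left)
  also have "\<dots> = cscale (of_real (- sin t) + of_real (cos t) * \<i>) e0 + cscale (of_real (cos t)) \<nu>"
    by (simp only: cscale_of_real scale_left_distrib scaleR_add_right add.assoc flip: scale_scale)
  also have "of_real (- sin t) + of_real (cos t) * \<i> = cis t * \<i>"
    by (simp add: complex_eq_iff)
  also have "of_real (cos t) = cis t * (cis (- t) * of_real (cos t))"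
    by (simp add: cis_mult flip: mult.assoc)
  finally show ?thesis
    by (simp add: scale_right_distrib)
qed

lemma kappa_mult_w: "amul (\<kappa> t) (w t) = e0"
proof -
  have "amul (\<kappa> t) (w t) = amul (amul (\<kappa> t) e0) (w t)"
    by (simp add: assoc e0_mult_w)
  also have "\<dots> = cscale (cis t * cis (- t)) (amul (e0 + cscale (q t) \<nu>) (geometric_sum t))"
    by (simp add: kappa_component w_def mult_cscale_left mult_cscale_right)
  also have "amul (e0 + cscale (q t) \<nu>) (geometric_sum t) = e0"
    by (simp add: mult_add_left mult_cscale_left e0_mult_geom geom_inverse)
  finally show ?thesis
    by (simp add: cis_mult)
qed

text \<open>
  The left-hand side is the logarithmic derivative of the circle.  Since the circle is \<open>cis t\<close>
  times \<open>e0 + q t \<nu>\<close> in the ideal, it is the sum of the logarithmic derivatives of these factors.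
\<close>

lemma log_derivative: "amul (\<kappa>' t) (w t) = cscale \<i> e0 + cscale (q' t) (amul \<nu> (geometric_sum t))"
proof -
  have "amul (\<kappa>' t) (w t) = amul (amul (\<kappa>' t) e0) (w t)"
    by (simp add: assoc e0_mult_w)
  also have "\<dots> = cscale (cis t * cis (- t))
      (amul (cscale \<i> e0 + cscale (cis (- t) * of_real (cos t)) \<nu>) (geometric_sum t))"
    by (simp add: kappa'_component w_def mult_cscale_left mult_cscale_right)
  also have "\<dots> = cscale \<i> (geometric_sum t) + cscale (cis (- t) * of_real (cos t)) (amul \<nu> (geometric_sum t))"
    by (simp add: cis_mult mult_add_left mult_cscale_left e0_mult_geom)
  also have "cscale \<i> (geometric_sum t) = cscale \<i> e0 - cscale (\<i> * q t) (amul \<nu> (geometric_sum t))"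
    using arg_cong[OF geom_inverse[of t], of "cscale \<i>"]
    by (simp add: scale_right_distrib eq_diff_eq)
  finally show ?thesis
    by (simp add: q'_def scale_left_diff_distrib)
qed

lemma q_deriv: "(q has_vector_derivative q' t) (at t within S)"
  unfolding q_def q'_def has_vector_derivative_def
  by (auto intro!: derivative_eq_intros simp: algebra_simps scaleR_conv_of_real)

lemma q_zero: "q 0 = 0" "q (2 * pi) = 0"
  by (simp_all add: q_def)

lemma kappa_deriv: "(\<kappa> has_vector_derivative \<kappa>' t) (at t within S)"
  unfolding \<kappa>_def \<kappa>'_def has_vector_derivative_def
  by (auto intro!: derivative_eq_intros simp: algebra_simps)

text \<open>
  That \<open>w\<close> has a derivative is clear from the formula for it; the value of the derivative comes
  from differentiating \<open>\<kappa> w = e0\<close>.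
\<close>

lemma w_deriv: "(w has_vector_derivative - amul (w t) (amul (w t) (\<kappa>' t))) (at t within S)"
proof -
  have w_sum: "w t = (\<Sum>j<N. cscale (cis (- t) * (- q t) ^ j) ((amul \<nu> ^^ j) e0))" for t
    by (simp add: w_def geometric_sum_def linear_sum[OF linear_cscale_right])
  have q_diff: "q differentiable at t"
    using q_deriv by (rule differentiableI_vector)
  have cis_diff: "(\<lambda>t. cis (- t)) differentiable at t"
    unfolding differentiable_def by (auto intro!: derivative_eq_intros)
  have "(\<lambda>t. cis (- t) * (- q t) ^ j) differentiable at t" for j
    using q_diff cis_diff by (intro differentiable_mult differentiable_power) auto
  then have "((\<lambda>t. cis (- t) * (- q t) ^ j) has_vector_derivative
      vector_derivative (\<lambda>t. cis (- t) * (- q t) ^ j) (at t)) (at t)" for j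
    by (simp add: vector_derivative_works)
  then have "((\<lambda>t. \<Sum>j<N. cscale (cis (- t) * (- q t) ^ j) ((amul \<nu> ^^ j) e0)) has_vector_derivative
      (\<Sum>j<N. cscale (vector_derivative (\<lambda>t. cis (- t) * (- q t) ^ j) (at t)) ((amul \<nu> ^^ j) e0))) (at t)"
    by (intro has_vector_derivative_sum has_vector_derivative_cscale)
  then obtain d where d: "(w has_vector_derivative d) (at t)"
    unfolding w_sum[abs_def, symmetric] by blast
  have "((\<lambda>t. amul (\<kappa> t) (w t)) has_vector_derivative amul (\<kappa> t) d + amul (\<kappa>' t) (w t)) (at t)"
    using kappa_deriv d by (rule bounded_bilinear.has_vector_derivative[OF bounded_bilinear_mult])
  then have "((\<lambda>t. e0) has_vector_derivative amul (\<kappa> t) d + amul (\<kappa>' t) (w t)) (at t)"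
    by (simp only: kappa_mult_w)
  then have zero: "amul (\<kappa> t) d + amul (\<kappa>' t) (w t) = 0"
    using has_vector_derivative_const vector_derivative_unique_at by blast
  have "((\<lambda>t. amul e0 (w t)) has_vector_derivative amul e0 d) (at t)"
    using d by (rule bounded_linear.has_vector_derivative[OF bounded_linear_mult_right])
  then have "(w has_vector_derivative amul e0 d) (at t)"
    by (simp only: e0_mult_w)
  then have "d = amul e0 d"
    using d vector_derivative_unique_at by blast
  also have "\<dots> = amul (w t) (amul (\<kappa> t) d)"
    by (simp add: kappa_mult_w commute[of "w t"] flip: assoc)
  also have "amul (\<kappa> t) d = - amul (\<kappa>' t) (w t)"
    using zero by (simp add: eq_neg_iff_add_eq_0)
  also have "amul (w t) (- amul (\<kappa>' t) (w t)) = - amul (w t) (amul (w t) (\<kappa>' t))"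
    by (simp add: linear_neg[OF linear_mult_right] commute)
  finally show ?thesis
    using d has_vector_derivative_at_within by blast
qed

lemma period: "\<kappa> (2 * pi) = \<kappa> 0" "w (2 * pi) = w 0"
  by (simp_all add: \<kappa>_def w_def geometric_sum_def q_zero cis_2pi flip: cis_inverse)

text \<open>
  The nilpotent part of the logarithmic derivative is the derivative of a polynomial in \<open>q\<close>
  without constant term, the logarithm of \<open>e0 + q t \<nu>\<close>.  Because \<open>q\<close> vanishes at both ends,
  only the scalar part contributes to the integral.
\<close>

lemma residue: "((\<lambda>t. amul (\<kappa>' t) (w t)) has_integral cscale (2 * of_real pi * \<i>) e0) {0..2 * pi}"
proof -
  let ?A = "\<lambda>t. cscale (\<i> * of_real t) e0 +
    (\<Sum>j<N. cscale ((- 1) ^ j * q t ^ Suc j / of_nat (Suc j)) ((amul \<nu> ^^ Suc j) e0))"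
  have "(?A has_vector_derivative amul (\<kappa>' t) (w t)) (at t within {0..2 * pi})" for t
  proof -
    have lin: "((\<lambda>t. \<i> * of_real t) has_vector_derivative \<i>) (at t within {0..2 * pi})"
      unfolding has_vector_derivative_def
      by (auto intro!: derivative_eq_intros simp: scaleR_conv_of_real)
    have pow: "((\<lambda>t. (- 1) ^ j * q t ^ Suc j / of_nat (Suc j)) has_vector_derivative
        q' t * (- q t) ^ j) (at t within {0..2 * pi})" for j
    proof -
      have "((\<lambda>z. z ^ Suc j) has_field_derivative of_nat (Suc j) * (1 * q t ^ (Suc j - Suc 0))) (at (q t))"
        by (rule DERIV_power[OF DERIV_ident])
      from DERIV_cdivide[OF DERIV_cmult[OF this]]
      have "((\<lambda>z. (- 1) ^ j * z ^ Suc j / of_nat (Suc j)) has_field_derivative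
          (- 1) ^ j * (of_nat (Suc j) * q t ^ j) / of_nat (Suc j)) (at (q t))"
        by (simp only: diff_Suc_Suc diff_zero mult_1_left)
      also have "(- 1) ^ j * (of_nat (Suc j) * q t ^ j) / of_nat (Suc j) = (- q t) ^ j"
        by (simp add: power_minus[of "q t"] del: of_nat_Suc)
      finally show ?thesis
        using field_vector_diff_chain_at[OF q_deriv]
        by (auto simp: o_def intro: has_vector_derivative_at_within)
    qed
    have "(?A has_vector_derivative cscale \<i> e0 +
        (\<Sum>j<N. cscale (q' t * (- q t) ^ j) ((amul \<nu> ^^ Suc j) e0))) (at t within {0..2 * pi})"
      by (intro has_vector_derivative_add has_vector_derivative_sum has_vector_derivative_cscale lin pow)
    also have "(\<Sum>j<N. cscale (q' t * (- q t) ^ j) ((amul \<nu> ^^ Suc j) e0)) =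
        cscale (q' t) (amul \<nu> (geometric_sum t))"
      by (simp add: nu_mult_geom linear_sum[OF linear_cscale_right])
    finally show ?thesis
      by (simp only: log_derivative)
  qed
  then have "((\<lambda>t. amul (\<kappa>' t) (w t)) has_integral ?A (2 * pi) - ?A 0) {0..2 * pi}"
    by (intro fundamental_theorem) auto
  then show ?thesis
    unfolding q_zero by (simp add: mult_ac)
qed

text \<open>
  The algebra-valued counterpart of the Cauchy kernel \<open>dz / z\<^sup>2\<close> on the unit circle.
\<close>

definition kernel :: "real \<Rightarrow> 'a" where
  "kernel t = amul (w t) (amul (w t) (\<kappa>' t))"

lemma continuous_kappa': "continuous_on S \<kappa>'"
  unfolding \<kappa>'_def by (intro continuous_intros)

lemma continuous_w: "continuous_on S w"
  by (rule continuous_on_vector_derivative) (rule w_deriv)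

lemma continuous_kernel: "continuous_on S kernel"
  unfolding kernel_def by (intro continuous_on_mult continuous_w continuous_kappa')

text \<open>
  Let \<open>g s\<close> be the integral of \<open>F\<close> against the kernel over the circle of radius \<open>s\<close> about
  \<open>x\<close>, and \<open>M s\<close> that of \<open>P\<close> against \<open>w \<kappa>'\<close>.  Differentiation in \<open>s\<close> gives
  \<open>g' = M\<close> because \<open>\<kappa> w = e0\<close>, and integration by parts along the circle gives
  \<open>g s = s M s\<close>.  Together these say that \<open>M\<close> is constant, and its value at the centre is known
  from the residue.  The circle is translated along with its centre \<open>x\<close>, so that neither the
  radius nor the kernel depends on \<open>x\<close>.
\<close>

lemma kernel_formula:
  fixes E :: "'v::real_normed_vector \<Rightarrow> 'a" and F P :: "'v \<Rightarrow> 'a"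
  assumes E: "bounded_linear E" "E v1 = one" "E v2 = h"
    and F: "\<And>y. y \<in> S \<Longrightarrow> (F has_derivative (\<lambda>d. amul (E d) (P y))) (at y)"
    and P: "continuous_on S P"
    and S: "\<And>s t. s \<in> {0..r} \<Longrightarrow> x + s *\<^sub>R (cos t *\<^sub>R v1 + sin t *\<^sub>R v2) \<in> S"
    and r: "0 < r"
  shows "cscale (2 * of_real pi * \<i>) (amul e0 (P x)) =
    inverse r *\<^sub>R integral {0..2 * pi} (\<lambda>t. amul (F (x + r *\<^sub>R (cos t *\<^sub>R v1 + sin t *\<^sub>R v2))) (kernel t))"
proof -
  define K where "K = (\<lambda>t. cos t *\<^sub>R v1 + sin t *\<^sub>R v2)"
  define K' where "K' = (\<lambda>t. - sin t *\<^sub>R v1 + cos t *\<^sub>R v2)"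
  define g where "g = (\<lambda>s. integral {0..2 * pi} (\<lambda>t. amul (F (x + s *\<^sub>R K t)) (kernel t)))"
  define M where "M = (\<lambda>s. integral {0..2 * pi} (\<lambda>t. amul (P (x + s *\<^sub>R K t)) (amul (w t) (\<kappa>' t))))"
  have EK: "E (K t) = \<kappa> t" "E (K' t) = \<kappa>' t" for t
    unfolding K_def K'_def \<kappa>_def \<kappa>'_def
    by (simp_all add: bounded_linear.linear[OF E(1), THEN linear_add]
        bounded_linear.linear[OF E(1), THEN linear_scale]
        bounded_linear.linear[OF E(1), THEN linear_diff] E)
  have inS: "x + s *\<^sub>R K t \<in> S" if "s \<in> {0..r}" for s t
    using S[OF that] by (simp add: K_def)
  have chain: "((\<lambda>s. F (c s)) has_vector_derivative amul (E c') (P (c s))) (at s within T)"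
    if c: "(c has_vector_derivative c') (at s within T)" "c s \<in> S" for c c' s T
  proof -
    have "((\<lambda>s. F (c s)) has_derivative (\<lambda>d. amul (E (d *\<^sub>R c')) (P (c s)))) (at s within T)"
      using has_derivative_compose[OF c(1)[unfolded has_vector_derivative_def] F[OF c(2)]] .
    then show ?thesis
      by (simp add: has_vector_derivative_def mult_scaleR_left
          bounded_linear.linear[OF E(1), THEN linear_scale])
  qed
  have contF: "continuous_on S F"
    by (rule has_derivative_continuous_on) (rule has_derivative_at_withinI[OF F])
  have contK: "continuous_on T K" for T
    unfolding K_def by (intro continuous_intros)
  have contPath: "continuous_on ({0..r} \<times> {0..2 * pi}) (\<lambda>(s, t). f (x + s *\<^sub>R K t))"
    if "continuous_on S f" for f :: "'v \<Rightarrow> 'a"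
    unfolding case_prod_unfold using inS
    by (intro continuous_on_compose2[OF that] continuous_intros continuous_on_compose2[OF contK[of UNIV]]) auto
  have contSlice: "continuous_on T (\<lambda>t. f (x + s *\<^sub>R K t))"
    if "continuous_on S f" "s \<in> {0..r}" for f :: "'v \<Rightarrow> 'a" and s T
    using inS[OF that(2)]
    by (intro continuous_on_compose2[OF that(1)] continuous_intros contK) auto
  \<comment> \<open>The factor \<open>\<kappa>\<close> that differentiation in \<open>s\<close> produces cancels one factor \<open>w\<close> of the kernel.\<close>
  have g_deriv: "(g has_vector_derivative M s) (at s within {0..r})" if s: "s \<in> {0..r}" for s
    unfolding g_def M_def
  proof (rule derivative_under_integral[OF _ _ _ s])
    fix \<sigma> t assume \<sigma>: "\<sigma> \<in> {0..r}" "t \<in> {0..2 * pi}"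
    have "((\<lambda>\<sigma>. F (x + \<sigma> *\<^sub>R K t)) has_vector_derivative amul (\<kappa> t) (P (x + \<sigma> *\<^sub>R K t))) (at \<sigma> within {0..r})"
    proof -
      have "((\<lambda>\<sigma>. x + \<sigma> *\<^sub>R K t) has_vector_derivative K t) (at \<sigma> within {0..r})"
        unfolding has_vector_derivative_def by (auto intro!: derivative_eq_intros)
      from chain[OF this inS[OF \<sigma>(1)]] show ?thesis by (simp only: EK)
    qed
    then have "((\<lambda>\<sigma>. amul (F (x + \<sigma> *\<^sub>R K t)) (kernel t)) has_vector_derivative
        amul (amul (\<kappa> t) (P (x + \<sigma> *\<^sub>R K t))) (kernel t)) (at \<sigma> within {0..r})"
      by (rule bounded_linear.has_vector_derivative[OF bounded_linear_mult_left])
    also have "amul (amul (\<kappa> t) (P (x + \<sigma> *\<^sub>R K t))) (kernel t) =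
        amul (P (x + \<sigma> *\<^sub>R K t)) (amul (amul (amul (\<kappa> t) (w t)) (w t)) (\<kappa>' t))"
      by (simp add: kernel_def ac_simps)
    also have "\<dots> = amul (P (x + \<sigma> *\<^sub>R K t)) (amul (w t) (\<kappa>' t))"
      by (simp add: kappa_mult_w e0_mult_w)
    finally show "((\<lambda>\<sigma>. amul (F (x + \<sigma> *\<^sub>R K t)) (kernel t)) has_vector_derivative
        amul (P (x + \<sigma> *\<^sub>R K t)) (amul (w t) (\<kappa>' t))) (at \<sigma> within {0..r})" .
  next
    show "continuous_on {0..2 * pi} (\<lambda>t. amul (F (x + s *\<^sub>R K t)) (kernel t))" if "s \<in> {0..r}" for s
      by (intro continuous_on_mult contSlice contF that continuous_kernel)
  next
    show "continuous_on ({0..r} \<times> {0..2 * pi})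
        (\<lambda>(s, t). amul (P (x + s *\<^sub>R K t)) (amul (w t) (\<kappa>' t)))"
      unfolding case_prod_unfold
      by (intro continuous_on_mult contPath[OF P, unfolded case_prod_unfold]
          continuous_on_compose2[OF continuous_w[of UNIV]]
          continuous_on_compose2[OF continuous_kappa'[of UNIV]] continuous_intros) auto
  qed simp
  have contM: "continuous_on {0..r} M"
    unfolding M_def
  proof (rule continuous_parametric_integral)
    show "continuous_on ({0..r} \<times> {0..2 * pi})
        (\<lambda>(s, t). amul (P (x + s *\<^sub>R K t)) (amul (w t) (\<kappa>' t)))"
      unfolding case_prod_unfold
      by (intro continuous_on_mult contPath[OF P, unfolded case_prod_unfold]
          continuous_on_compose2[OF continuous_w[of UNIV]]
          continuous_on_compose2[OF continuous_kappa'[of UNIV]] continuous_intros) auto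
  qed
  have by_parts: "g s = s *\<^sub>R M s" if s: "s \<in> {0..r}" for s
  proof -
    let ?a = "\<lambda>t. amul (P (x + s *\<^sub>R K t)) (amul (w t) (\<kappa>' t))"
    let ?b = "\<lambda>t. amul (F (x + s *\<^sub>R K t)) (kernel t)"
    have "((\<lambda>t. amul (F (x + s *\<^sub>R K t)) (w t)) has_vector_derivative s *\<^sub>R ?a t - ?b t)
        (at t within {0..2 * pi})" for t
    proof -
      have K: "(K has_vector_derivative K' t) (at t within {0..2 * pi})"
        unfolding K_def K'_def has_vector_derivative_def
        by (auto intro!: derivative_eq_intros simp: algebra_simps)
      have "((\<lambda>t. F (x + s *\<^sub>R K t)) has_vector_derivative s *\<^sub>R amul (\<kappa>' t) (P (x + s *\<^sub>R K t)))
          (at t within {0..2 * pi})"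
      proof -
        have "((\<lambda>t. x + s *\<^sub>R K t) has_vector_derivative s *\<^sub>R K' t) (at t within {0..2 * pi})"
          using K unfolding has_vector_derivative_def by (auto intro!: derivative_eq_intros)
        from chain[OF this inS[OF s]] show ?thesis
          by (simp add: EK mult_scaleR_left bounded_linear.linear[OF E(1), THEN linear_scale])
      qed
      from bounded_bilinear.has_vector_derivative[OF bounded_bilinear_mult this w_deriv]
      show ?thesis
        by (simp add: kernel_def mult_scaleR_left mult_scaleR_right linear_neg[OF linear_mult_right] ac_simps)
    qed
    then have "((\<lambda>t. s *\<^sub>R ?a t - ?b t) has_integral
        amul (F (x + s *\<^sub>R K (2 * pi))) (w (2 * pi)) - amul (F (x + s *\<^sub>R K 0)) (w 0)) {0..2 * pi}"
      by (intro fundamental_theorem) auto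
    moreover have "K (2 * pi) = K 0"
      by (simp add: K_def)
    ultimately have zero: "((\<lambda>t. s *\<^sub>R ?a t - ?b t) has_integral 0) {0..2 * pi}"
      by (simp add: period)
    have "(?a has_integral M s) {0..2 * pi}" "(?b has_integral g s) {0..2 * pi}"
      unfolding M_def g_def
      by (intro continuous_has_integral continuous_on_mult contSlice P contF s continuous_w
          continuous_kappa' continuous_kernel)+
    then have "((\<lambda>t. s *\<^sub>R ?a t - ?b t) has_integral s *\<^sub>R M s - g s) {0..2 * pi}"
      by (intro has_integral_diff has_integral_cmul)
    from has_integral_unique[OF this zero] show ?thesis
      by simp
  qed
  \<comment> \<open>Away from the centre \<open>M s = g s / s\<close>, with derivative \<open>(s M s - g s) / s\<^sup>2 = 0\<close>.\<close>
  have M_const: "M s = M r" if s: "0 < s" "s \<le> r" for s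
  proof -
    have deriv: "(M has_vector_derivative 0) (at \<sigma> within {s..r})" if \<sigma>: "\<sigma> \<in> {s..r}" for \<sigma>
    proof -
      have "((\<lambda>\<sigma>. inverse \<sigma> *\<^sub>R g \<sigma>) has_vector_derivative
          inverse \<sigma> *\<^sub>R M \<sigma> + (- inverse (\<sigma> ^ 2)) *\<^sub>R g \<sigma>) (at \<sigma> within {s..r})"
      proof (rule has_vector_derivative_scaleR)
        show "(inverse has_field_derivative - inverse (\<sigma> ^ 2)) (at \<sigma> within {s..r})"
          using \<sigma> s by (auto intro!: derivative_eq_intros simp: power2_eq_square)
        show "(g has_vector_derivative M \<sigma>) (at \<sigma> within {s..r})"
          using \<sigma> s by (intro has_vector_derivative_within_subset[OF g_deriv]) auto
      qed
      also have "inverse \<sigma> *\<^sub>R M \<sigma> + (- inverse (\<sigma> ^ 2)) *\<^sub>R g \<sigma> = 0"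
        using \<sigma> s by (simp add: by_parts power2_eq_square)
      finally show ?thesis
        by (rule has_vector_derivative_transform[OF \<sigma>, rotated]) (use s in \<open>auto simp: by_parts\<close>)
    qed
    obtain c where "\<And>\<sigma>. \<sigma> \<in> {s..r} \<Longrightarrow> M \<sigma> = c"
      by (rule has_vector_derivative_zero_constant[OF convex_real_interval(5) deriv],
          assumption, rule that, simp)
    then show ?thesis
      using s by simp
  qed
  have "eventually (\<lambda>s. M s = M r) (at_right 0)"
    using eventually_at_right_real[OF r] by (rule eventually_mono) (rule M_const, simp_all)
  then have "(M \<longlongrightarrow> M r) (at_right 0)"
    by (rule tendsto_eventually)
  moreover have "(M \<longlongrightarrow> M 0) (at_right 0)"
    using contM r by (auto simp: continuous_on_def simp flip: at_within_Icc_at_right[OF r])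
  ultimately have "M 0 = M r"
    using tendsto_unique[of "at_right (0::real)"] by auto
  moreover have "M 0 = cscale (2 * of_real pi * \<i>) (amul e0 (P x))"
  proof -
    have "((\<lambda>t. amul (P x) (amul (\<kappa>' t) (w t))) has_integral
        amul (P x) (cscale (2 * of_real pi * \<i>) e0)) {0..2 * pi}"
      using has_integral_linear[OF residue bounded_linear_mult_right] by (simp add: o_def)
    then show ?thesis
      by (simp add: M_def integral_unique mult_cscale_right commute)
  qed
  moreover have "inverse r *\<^sub>R g r = M r"
    using r by (simp add: by_parts)
  ultimately show ?thesis
    by (simp add: g_def K_def)
qed

text \<open>
  The integral formula expresses \<open>P\<close> through its primitive \<open>F\<close> over circles of one fixed
  radius.  A derivative in the centre therefore falls on \<open>F\<close>, which turns it into \<open>P\<close> and brings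
  out the factor \<open>E v\<close>; what remains under the integral does not depend on \<open>v\<close>.
\<close>

lemma component_derivative:
  fixes E :: "'v::real_normed_vector \<Rightarrow> 'a" and F P :: "'v \<Rightarrow> 'a"
  assumes E: "bounded_linear E" "E v1 = one" "E v2 = h"
    and F: "\<And>y. y \<in> ball x0 \<rho> \<Longrightarrow> (F has_derivative (\<lambda>d. amul (E d) (P y))) (at y)"
    and P: "continuous_on (ball x0 \<rho>) P"
    and \<rho>: "0 < \<rho>"
  shows "\<exists>d. \<forall>v. ((\<lambda>\<epsilon>. amul e0 (P (x0 + \<epsilon> *\<^sub>R v))) has_vector_derivative amul (E v) d) (at 0)"
proof -
  define K where "K = (\<lambda>t. cos t *\<^sub>R v1 + sin t *\<^sub>R v2)"
  define L where "L = norm v1 + norm v2 + 1"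
  have L: "L > 0"
    unfolding L_def by (smt (verit) norm_ge_zero)
  have K_bound: "norm (K t) \<le> L" for t
  proof -
    have "norm (K t) \<le> \<bar>cos t\<bar> * norm v1 + \<bar>sin t\<bar> * norm v2"
      unfolding K_def by (rule order_trans[OF norm_triangle_ineq]) simp
    also have "\<dots> \<le> 1 * norm v1 + 1 * norm v2"
      by (intro add_mono mult_right_mono) auto
    finally show ?thesis by (simp add: L_def)
  qed
  \<comment> \<open>Half of \<open>\<rho>\<close> is left for moving the centre, the other half for the circle.\<close>
  define r where "r = \<rho> / (2 * L)"
  have r: "r > 0"
    using \<rho> L by (simp add: r_def)
  have near: "x + s *\<^sub>R K t \<in> ball x0 \<rho>" if x: "dist x0 x < \<rho> / 2" and s: "s \<in> {0..r}" for x s t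
  proof -
    have "norm (s *\<^sub>R K t) \<le> r * L"
      using s K_bound[of t] r by (auto intro!: mult_mono)
    also have "r * L = \<rho> / 2"
      using L by (simp add: r_def)
    finally show ?thesis
      using x norm_triangle_ineq[of "x - x0" "s *\<^sub>R K t"]
      by (simp add: dist_norm norm_minus_commute add_diff_eq algebra_simps)
  qed
  have r': "r \<in> {0..r}" using r by simp
  let ?k = "inverse (2 * of_real pi * \<i>) :: complex"
  have formula: "amul e0 (P x) =
      cscale ?k (inverse r *\<^sub>R integral {0..2 * pi} (\<lambda>t. amul (F (x + r *\<^sub>R K t)) (kernel t)))"
    if x: "dist x0 x < \<rho> / 2" for x
  proof -
    have "cscale (2 * of_real pi * \<i>) (amul e0 (P x)) =
        inverse r *\<^sub>R integral {0..2 * pi} (\<lambda>t. amul (F (x + r *\<^sub>R K t)) (kernel t))"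
      unfolding K_def
      by (rule kernel_formula[OF E F P near[OF x, unfolded K_def] r])
    then have "cscale ?k (cscale (2 * of_real pi * \<i>) (amul e0 (P x))) =
        cscale ?k (inverse r *\<^sub>R integral {0..2 * pi} (\<lambda>t. amul (F (x + r *\<^sub>R K t)) (kernel t)))"
      by (rule arg_cong)
    moreover have "cscale ?k (cscale (2 * of_real pi * \<i>) z) = z" for z
    proof -
      have "?k * (2 * of_real pi * \<i>) = 1"
        by (rule left_inverse) simp
      then show ?thesis by (simp only: scale_scale scale_one)
    qed
    ultimately show ?thesis by (simp only:)
  qed
  define J where "J = integral {0..2 * pi} (\<lambda>t. amul (P (x0 + r *\<^sub>R K t)) (kernel t))"
  have "((\<lambda>\<epsilon>. amul e0 (P (x0 + \<epsilon> *\<^sub>R v))) has_vector_derivative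
      amul (E v) (cscale ?k (inverse r *\<^sub>R J))) (at 0)" for v
  proof -
    define \<delta> where "\<delta> = \<rho> / (4 * (norm v + 1))"
    have v1: "norm v + 1 > 0"
      by (smt (verit) norm_ge_zero)
    then have \<delta>: "\<delta> > 0"
      using \<rho> by (simp add: \<delta>_def)
    have "\<rho> / (4 * b) * b = \<rho> / 4" if "b > 0" for b
      using that by simp
    from this[OF v1] have \<delta>_eq: "\<delta> * (norm v + 1) = \<rho> / 4"
      unfolding \<delta>_def .
    have close: "dist x0 (x0 + \<epsilon> *\<^sub>R v) < \<rho> / 2" if "\<epsilon> \<in> {-\<delta>..\<delta>}" for \<epsilon>
    proof -
      have "\<bar>\<epsilon>\<bar> * norm v \<le> \<delta> * (norm v + 1)"
        using that \<delta> by (intro mult_mono) auto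
      also have "\<dots> = \<rho> / 4"
        by (rule \<delta>_eq)
      finally show ?thesis
        using \<rho> by (simp add: dist_norm)
    qed
    have contF: "continuous_on (ball x0 \<rho>) F"
      by (rule has_derivative_continuous_on) (rule has_derivative_at_withinI[OF F])
    have contK: "continuous_on T K" for T
      unfolding K_def by (intro continuous_intros)
    have "((\<lambda>\<epsilon>. integral {0..2 * pi} (\<lambda>t. amul (F (x0 + \<epsilon> *\<^sub>R v + r *\<^sub>R K t)) (kernel t))) has_vector_derivative
        integral {0..2 * pi} (\<lambda>t. amul (amul (E v) (P (x0 + 0 *\<^sub>R v + r *\<^sub>R K t))) (kernel t)))
        (at 0 within {-\<delta>..\<delta>})"
    proof (rule derivative_under_integral)
      fix \<epsilon> t assume \<epsilon>: "\<epsilon> \<in> {-\<delta>..\<delta>}" "t \<in> {0..2 * pi}"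
      have "((\<lambda>\<epsilon>. x0 + \<epsilon> *\<^sub>R v + r *\<^sub>R K t) has_derivative (\<lambda>d. d *\<^sub>R v)) (at \<epsilon> within {-\<delta>..\<delta>})"
        by (auto intro!: derivative_eq_intros)
      from has_derivative_compose[OF this F[OF near[OF close[OF \<epsilon>(1)] r']]]
      have "((\<lambda>\<epsilon>. F (x0 + \<epsilon> *\<^sub>R v + r *\<^sub>R K t)) has_vector_derivative
          amul (E v) (P (x0 + \<epsilon> *\<^sub>R v + r *\<^sub>R K t))) (at \<epsilon> within {-\<delta>..\<delta>})"
        by (simp add: has_vector_derivative_def mult_scaleR_left
            bounded_linear.linear[OF E(1), THEN linear_scale])
      then show "((\<lambda>\<epsilon>. amul (F (x0 + \<epsilon> *\<^sub>R v + r *\<^sub>R K t)) (kernel t)) has_vector_derivative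
          amul (amul (E v) (P (x0 + \<epsilon> *\<^sub>R v + r *\<^sub>R K t))) (kernel t)) (at \<epsilon> within {-\<delta>..\<delta>})"
        by (rule bounded_linear.has_vector_derivative[OF bounded_linear_mult_left])
    next
      fix \<epsilon> assume \<epsilon>: "\<epsilon> \<in> {-\<delta>..\<delta>}"
      show "continuous_on {0..2 * pi} (\<lambda>t. amul (F (x0 + \<epsilon> *\<^sub>R v + r *\<^sub>R K t)) (kernel t))"
        using near[OF close[OF \<epsilon>] r']
        by (intro continuous_on_mult continuous_kernel continuous_on_compose2[OF contF]
            continuous_intros contK) auto
    next
      show "continuous_on ({-\<delta>..\<delta>} \<times> {0..2 * pi})
          (\<lambda>(\<epsilon>, t). amul (amul (E v) (P (x0 + \<epsilon> *\<^sub>R v + r *\<^sub>R K t))) (kernel t))"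
        unfolding case_prod_unfold using near[OF close r']
        by (intro continuous_on_mult continuous_on_const continuous_on_compose2[OF P]
            continuous_on_compose2[OF continuous_kernel[of UNIV]]
            continuous_on_compose2[OF contK[of UNIV]] continuous_intros) auto
    qed (use \<delta> in auto)
    moreover have "integral {0..2 * pi} (\<lambda>t. amul (amul (E v) (P (x0 + 0 *\<^sub>R v + r *\<^sub>R K t))) (kernel t))
        = amul (E v) J"
    proof -
      have "continuous_on {0..2 * pi} (\<lambda>t. amul (P (x0 + r *\<^sub>R K t)) (kernel t))"
        using near[of x0, OF _ r'] \<rho>
        by (intro continuous_on_mult continuous_kernel continuous_on_compose2[OF P]
            continuous_intros contK) auto
      from has_integral_linear[OF continuous_has_integral[OF this] bounded_linear_mult_right]
      show ?thesis
        by (intro integral_unique) (simp add: J_def o_def assoc)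
    qed
    ultimately have "((\<lambda>\<epsilon>. integral {0..2 * pi} (\<lambda>t. amul (F (x0 + \<epsilon> *\<^sub>R v + r *\<^sub>R K t)) (kernel t)))
        has_vector_derivative amul (E v) J) (at 0 within {-\<delta>..\<delta>})"
      by simp
    then have "((\<lambda>\<epsilon>. cscale ?k (inverse r *\<^sub>R
        integral {0..2 * pi} (\<lambda>t. amul (F (x0 + \<epsilon> *\<^sub>R v + r *\<^sub>R K t)) (kernel t))))
        has_vector_derivative cscale ?k (inverse r *\<^sub>R amul (E v) J)) (at 0 within {-\<delta>..\<delta>})"
      by (intro bounded_linear.has_vector_derivative[OF bounded_linear_cscale_right]
          bounded_linear.has_vector_derivative[OF bounded_linear_scaleR_right])
    also have "cscale ?k (inverse r *\<^sub>R amul (E v) J) = amul (E v) (cscale ?k (inverse r *\<^sub>R J))"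
      by (simp only: mult_cscale_right mult_scaleR_right)
    finally have "((\<lambda>\<epsilon>. amul e0 (P (x0 + \<epsilon> *\<^sub>R v))) has_vector_derivative
        amul (E v) (cscale ?k (inverse r *\<^sub>R J))) (at 0 within {-\<delta>..\<delta>})"
      by (rule has_vector_derivative_transform[rotated 2]) (use \<delta> formula[OF close] in auto)
    then show ?thesis
      using \<delta> by (simp add: at_within_Icc_at)
  qed
  then show ?thesis by blast
qed

end

section \<open>Primitives from triangle integrals\<close>

context finite_dim_algebra
begin

text \<open>
  The integral of \<open>P\<close> along the segment from \<open>a\<close> to \<open>b\<close>, where \<open>E\<close> sends coordinates to
  elements of the algebra: the velocity of the segment is the constant \<open>E (b - a)\<close>.
\<close>

definition segment_integral :: "('v::real_normed_vector \<Rightarrow> 'a) \<Rightarrow> ('v \<Rightarrow> 'a) \<Rightarrow> 'v \<Rightarrow> 'v \<Rightarrow> 'a" where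
  "segment_integral E P a b = amul (E (b - a)) (integral {0..1} (\<lambda>t. P (linepath a b t)))"

lemma continuous_on_linepath_compose:
  fixes P :: "'v::real_normed_vector \<Rightarrow> 'a"
  assumes "continuous_on (closed_segment a b) P"
  shows "continuous_on {0..1} (\<lambda>t. P (linepath a b t))"
  by (rule continuous_on_compose2[OF assms continuous_on_linepath])
    (auto simp: linepath_in_path)

lemma segment_integral_on_line:
  fixes P :: "'v::real_normed_vector \<Rightarrow> 'a"
  assumes E: "linear E"
    and G: "\<And>s. s \<in> {l..u} \<Longrightarrow> (G has_vector_derivative P (a + s *\<^sub>R v)) (at s within {l..u})"
    and P: "continuous_on ((\<lambda>s. a + s *\<^sub>R v) ` {l..u}) P"
    and ends: "\<alpha> \<in> {l..u}" "\<beta> \<in> {l..u}"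
  shows "segment_integral E P (a + \<alpha> *\<^sub>R v) (a + \<beta> *\<^sub>R v) = amul (E v) (G \<beta> - G \<alpha>)"
proof -
  let ?c = "\<lambda>t. (1 - t) * \<alpha> + t * \<beta>"
  have path: "linepath (a + \<alpha> *\<^sub>R v) (a + \<beta> *\<^sub>R v) t = a + ?c t *\<^sub>R v" for t
    by (simp add: linepath_def algebra_simps)
  have c_in: "?c t \<in> {l..u}" if "t \<in> {0..1}" for t
    using convexD[OF convex_real_interval(5) ends, of "1 - t" t] that by simp
  have cont: "continuous_on {0..1} (\<lambda>t. P (a + ?c t *\<^sub>R v))"
    by (rule continuous_on_compose2[OF P]) (use c_in in \<open>auto intro!: continuous_intros\<close>)
  have "((\<lambda>t. G (?c t)) has_vector_derivative (\<beta> - \<alpha>) *\<^sub>R P (a + ?c t *\<^sub>R v)) (at t within {0..1})"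
    if t: "t \<in> {0..1}" for t
  proof -
    have "(?c has_vector_derivative \<beta> - \<alpha>) (at t within {0..1})"
      unfolding has_vector_derivative_def by (auto intro!: derivative_eq_intros simp: algebra_simps)
    moreover have "(G has_vector_derivative P (a + ?c t *\<^sub>R v)) (at (?c t) within ?c ` {0..1})"
      by (rule has_vector_derivative_within_subset[OF G[OF c_in[OF t]]]) (use c_in in auto)
    ultimately show ?thesis
      using vector_diff_chain_within[of ?c "\<beta> - \<alpha>" t "{0..1}" G] by (simp only: o_def)
  qed
  then have "((\<lambda>t. (\<beta> - \<alpha>) *\<^sub>R P (a + ?c t *\<^sub>R v)) has_integral G (?c 1) - G (?c 0)) {0..1}"
    by (intro fundamental_theorem) auto
  moreover have "((\<lambda>t. (\<beta> - \<alpha>) *\<^sub>R P (a + ?c t *\<^sub>R v)) has_integral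
      (\<beta> - \<alpha>) *\<^sub>R integral {0..1} (\<lambda>t. P (a + ?c t *\<^sub>R v))) {0..1}"
    by (intro has_integral_cmul continuous_has_integral cont)
  ultimately have "G (?c 1) - G (?c 0) = (\<beta> - \<alpha>) *\<^sub>R integral {0..1} (\<lambda>t. P (a + ?c t *\<^sub>R v))"
    by (rule has_integral_unique)
  then have "(\<beta> - \<alpha>) *\<^sub>R integral {0..1} (\<lambda>t. P (a + ?c t *\<^sub>R v)) = G \<beta> - G \<alpha>"
    by simp
  then show ?thesis
    by (simp add: segment_integral_def path mult_scaleR_left linear_scale[OF E] flip: scaleR_diff_left mult_scaleR_right)
qed

text \<open>
  On a line the three integrals are increments of a single antiderivative, and these cancel.  This
  covers the degenerate triangles, in particular a segment traversed back and forth.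
\<close>

lemma segment_integral_collinear:
  fixes P :: "'v::real_normed_vector \<Rightarrow> 'a"
  assumes E: "linear E" and P: "continuous_on S P" and S: "convex S" "{a, b, c} \<subseteq> S"
    and "collinear {a, b, c}"
  shows "segment_integral E P a b + segment_integral E P b c + segment_integral E P c a = 0"
proof -
  obtain v where v: "\<forall>x\<in>{a, b, c}. \<forall>y\<in>{a, b, c}. \<exists>s. x - y = s *\<^sub>R v"
    using \<open>collinear {a, b, c}\<close> unfolding collinear_def by blast
  then obtain \<beta> \<gamma> where "b - a = \<beta> *\<^sub>R v" "c - a = \<gamma> *\<^sub>R v" by blast
  then have bc: "b = a + \<beta> *\<^sub>R v" "c = a + \<gamma> *\<^sub>R v"
    by (simp_all add: algebra_simps)
  define l where "l = min 0 (min \<beta> \<gamma>)"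
  define u where "u = max 0 (max \<beta> \<gamma>)"
  have "convex {s. a + s *\<^sub>R v \<in> S}"
  proof (rule convexI)
    fix s t \<xi> \<mu> :: real
    assume "s \<in> {s. a + s *\<^sub>R v \<in> S}" "t \<in> {s. a + s *\<^sub>R v \<in> S}" "0 \<le> \<xi>" "0 \<le> \<mu>" "\<xi> + \<mu> = 1"
    then have "\<xi> *\<^sub>R (a + s *\<^sub>R v) + \<mu> *\<^sub>R (a + t *\<^sub>R v) \<in> S"
      using convexD[OF S(1)] by simp
    also have "\<xi> *\<^sub>R (a + s *\<^sub>R v) + \<mu> *\<^sub>R (a + t *\<^sub>R v) =
        (\<xi> + \<mu>) *\<^sub>R a + (\<xi> *\<^sub>R s + \<mu> *\<^sub>R t) *\<^sub>R v"
      by (simp add: algebra_simps)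
    finally show "\<xi> *\<^sub>R s + \<mu> *\<^sub>R t \<in> {s. a + s *\<^sub>R v \<in> S}"
      using \<open>\<xi> + \<mu> = 1\<close> by simp
  qed
  moreover have "l \<in> {s. a + s *\<^sub>R v \<in> S}" "u \<in> {s. a + s *\<^sub>R v \<in> S}" "l \<le> u"
    using S(2) by (auto simp: l_def u_def min_def max_def simp flip: bc)
  ultimately have "{l..u} \<subseteq> {s. a + s *\<^sub>R v \<in> S}"
    by (metis closed_segment_subset closed_segment_eq_real_ivl)
  then have line: "(\<lambda>s. a + s *\<^sub>R v) ` {l..u} \<subseteq> S" by auto
  then have P': "continuous_on ((\<lambda>s. a + s *\<^sub>R v) ` {l..u}) P"
    using P continuous_on_subset by blast
  have "continuous_on {l..u} (\<lambda>s. P (a + s *\<^sub>R v))"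
    by (rule continuous_on_compose2[OF P']) (auto intro!: continuous_intros)
  then obtain G where G: "\<And>s. s \<in> {l..u} \<Longrightarrow> (G has_vector_derivative P (a + s *\<^sub>R v)) (at s within {l..u})"
    using antiderivative by metis
  have ends: "0 \<in> {l..u}" "\<beta> \<in> {l..u}" "\<gamma> \<in> {l..u}"
    by (auto simp: l_def u_def)
  note segment_integral = segment_integral_on_line[OF E G P']
  have "segment_integral E P a b = amul (E v) (G \<beta> - G 0)" "segment_integral E P b c = amul (E v) (G \<gamma> - G \<beta>)"
    "segment_integral E P c a = amul (E v) (G 0 - G \<gamma>)"
    using segment_integral[OF _ ends(1,2)] segment_integral[OF _ ends(2,3)] segment_integral[OF _ ends(3,1)] by (simp_all add: bc)
  then have "segment_integral E P a b + segment_integral E P b c + segment_integral E P c a =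
      amul (E v) ((G \<beta> - G 0) + (G \<gamma> - G \<beta>) + (G 0 - G \<gamma>))"
    by (simp only: mult_add_right)
  then show ?thesis
    using linear_0[OF linear_mult_right] by simp
qed

text \<open>
  For closed triangles the increment of the integral from \<open>x0\<close> is the integral over the segment
  from \<open>x\<close> to \<open>y\<close>, that is \<open>E (y - x)\<close> times the mean of \<open>P\<close> over this segment, and the mean
  tends to \<open>P x\<close> by continuity.
\<close>

lemma primitive:
  fixes P :: "'v::real_normed_vector \<Rightarrow> 'a"
  assumes E: "bounded_linear E" and P: "continuous_on S P"
    and S: "open S" "convex S" "x0 \<in> S" "x \<in> S"
    and closed: "\<And>a b c. {a, b, c} \<subseteq> S \<Longrightarrow> segment_integral E P a b + segment_integral E P b c + segment_integral E P c a = 0"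
  shows "(segment_integral E P x0 has_derivative (\<lambda>d. amul (E d) (P x))) (at x)"
proof -
  interpret E: bounded_linear E by (rule E)
  define Q where "Q = (\<lambda>y. integral {0..1} (\<lambda>t. P (linepath x y t)))"
  have path_in: "linepath x y t \<in> S" if "y \<in> S" "t \<in> {0..1}" for y t
    using convexD[OF S(2) S(4) that(1), of "1 - t" t] that(2) by (simp add: linepath_def)
  have "continuous_on S Q"
    unfolding Q_def
  proof (rule continuous_parametric_integral)
    show "continuous_on (S \<times> {0..1}) (\<lambda>(y, t). P (linepath x y t))"
      unfolding case_prod_unfold
      by (rule continuous_on_compose2[OF P])
        (use path_in in \<open>auto simp: linepath_def intro!: continuous_intros\<close>)
  qed
  then have "(Q \<longlongrightarrow> Q x) (at x)"
    using S(1,4) by (simp add: continuous_on_eq_continuous_at isCont_def)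
  moreover have Qx: "Q x = P x"
    by (simp add: Q_def)
  ultimately have lim: "((\<lambda>y. norm (Q y - P x)) \<longlongrightarrow> 0) (at x)"
    by (simp add: LIM_zero tendsto_norm_zero)
  obtain C where C: "0 \<le> C" "\<And>a b. norm (amul (E a) b) \<le> norm a * norm b * C"
  proof -
    obtain C where "C \<ge> 0" "\<And>a b. norm (amul (E a) b) \<le> norm a * norm b * C"
      using bounded_bilinear.nonneg_bounded[OF bounded_bilinear.comp1[OF bounded_bilinear_mult E]]
      by blast
    then show thesis using that by blast
  qed
  have incr: "segment_integral E P x0 y - segment_integral E P x0 x = amul (E (y - x)) (Q y)" if y: "y \<in> S" for y
  proof -
    have "segment_integral E P y y = 0"
      using linear_0[OF linear_mult_left] by (simp add: segment_integral_def E.zero)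
    then have rev: "segment_integral E P y x0 = - segment_integral E P x0 y"
      using closed[of x0 y y] S y by (simp add: eq_neg_iff_add_eq_0 add.commute)
    have "segment_integral E P x0 x + segment_integral E P x y + segment_integral E P y x0 = 0"
      using closed[of x0 x y] S y by simp
    then have "segment_integral E P x0 y - segment_integral E P x0 x = segment_integral E P x y"
      unfolding rev by (simp add: algebra_simps)
    then show ?thesis
      by (simp add: segment_integral_def Q_def)
  qed
  obtain \<epsilon> where \<epsilon>: "\<epsilon> > 0" "ball x \<epsilon> \<subseteq> S"
    using S(1,4) open_contains_ball by blast
  show ?thesis
  proof (rule has_derivativeI_sandwich[OF \<epsilon>(1)])
    show "bounded_linear (\<lambda>d. amul (E d) (P x))"
      by (rule bounded_linear_compose[OF bounded_linear_mult_left E])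
    show "((\<lambda>y. norm (Q y - P x) * C) \<longlongrightarrow> 0) (at x within UNIV)"
      using tendsto_mult_left_zero[OF lim] by simp
    fix y assume y: "y \<in> UNIV" "y \<noteq> x" "dist y x < \<epsilon>"
    then have "y \<in> S"
      using \<epsilon> by (auto simp: dist_commute)
    have "segment_integral E P x0 y - segment_integral E P x0 x - amul (E (y - x)) (P x) = amul (E (y - x)) (Q y - P x)"
      by (simp add: incr[OF \<open>y \<in> S\<close>] linear_diff[OF linear_mult_right])
    then have "norm (segment_integral E P x0 y - segment_integral E P x0 x - amul (E (y - x)) (P x)) \<le>
        norm (y - x) * norm (Q y - P x) * C"
      using C by simp
    then show "norm (segment_integral E P x0 y - segment_integral E P x0 x - amul (E (y - x)) (P x)) / norm (y - x) \<le>
        norm (Q y - P x) * C"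
      using y by (simp add: pos_divide_le_eq mult_ac)
  qed
qed

end

section \<open>Curve integrals over triangles\<close>

text \<open>
  On the interior of the subinterval the curve has a constant velocity; the two ends, where the
  derivative of the whole curve may fail to exist, form a null set.
\<close>

lemma line_integral_affine_piece:
  fixes \<gamma> :: "real \<Rightarrow> real ^ 'k::finite" and U :: "real ^ 'k \<Rightarrow> real"
  assumes ab: "\<alpha> < \<beta>" "{\<alpha>..\<beta>} \<subseteq> {0..1}"
    and \<gamma>: "\<And>t. t \<in> {\<alpha>..\<beta>} \<Longrightarrow> \<gamma> t = linepath a b ((t - \<alpha>) / (\<beta> - \<alpha>))"
    and U: "continuous_on (closed_segment a b) U"
  shows "((\<lambda>t. U (\<gamma> t) * (vector_derivative \<gamma> (at t within {0..1}) $ j)) has_integral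
    (b - a) $ j * integral {0..1} (\<lambda>t. U (linepath a b t))) {\<alpha>..\<beta>}"
proof -
  define \<mu> where "\<mu> = 1 / (\<beta> - \<alpha>)"
  have \<mu>: "\<mu> > 0"
    using ab by (simp add: \<mu>_def)
  have deriv: "vector_derivative \<gamma> (at t within {0..1}) = \<mu> *\<^sub>R (b - a)" if t: "t \<in> {\<alpha><..<\<beta>}" for t
  proof -
    have "((\<lambda>t. linepath a b ((t - \<alpha>) / (\<beta> - \<alpha>))) has_vector_derivative \<mu> *\<^sub>R (b - a)) (at t)"
      unfolding linepath_def has_vector_derivative_def \<mu>_def
      by (auto intro!: derivative_eq_intros simp: algebra_simps divide_inverse)
    then have "(\<gamma> has_vector_derivative \<mu> *\<^sub>R (b - a)) (at t)"
      by (rule has_vector_derivative_transform_within_open[OF _ open_greaterThanLessThan t])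
        (simp add: \<gamma>)
    then show ?thesis
      using t ab by (intro vector_derivative_at_within_ivl) auto
  qed
  have "continuous_on {0..1} (\<lambda>t. U (linepath a b t))"
    by (rule continuous_on_compose2[OF U continuous_on_linepath]) (auto simp: linepath_in_path)
  then have "((\<lambda>t. U (linepath a b t)) has_integral integral {0..1} (\<lambda>t. U (linepath a b t))) (cbox 0 1)"
    by (simp add: integrable_continuous_interval integrable_integral)
  from has_integral_affinity'[OF this \<mu>, of "- (\<alpha> * \<mu>)"]
  have scaled: "((\<lambda>t. U (linepath a b (\<mu> * t - \<alpha> * \<mu>))) has_integral
      integral {0..1} (\<lambda>t. U (linepath a b t)) / \<mu>)
      (cbox ((0 - - (\<alpha> * \<mu>)) /\<^sub>R \<mu>) ((1 - - (\<alpha> * \<mu>)) /\<^sub>R \<mu>))"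
    by (simp add: divide_inverse mult.commute)
  have "(0 - - (\<alpha> * \<mu>)) /\<^sub>R \<mu> = \<alpha>"
    using \<mu> by simp
  moreover have "(1 - - (\<alpha> * \<mu>)) /\<^sub>R \<mu> = \<beta>"
  proof -
    have "(1 - - (\<alpha> * \<mu>)) /\<^sub>R \<mu> = inverse \<mu> + \<alpha>"
      using \<mu> by (simp add: distrib_left)
    then show ?thesis by (simp add: \<mu>_def)
  qed
  ultimately have "((\<lambda>t. U (linepath a b (\<mu> * t - \<alpha> * \<mu>))) has_integral
      integral {0..1} (\<lambda>t. U (linepath a b t)) / \<mu>) {\<alpha>..\<beta>}"
    using scaled by (simp only: cbox_interval)
  from has_integral_mult_left[OF this, of "\<mu> * (b - a) $ j"]
  have "((\<lambda>t. U (linepath a b (\<mu> * t - \<alpha> * \<mu>)) * (\<mu> * (b - a) $ j)) has_integral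
      (b - a) $ j * integral {0..1} (\<lambda>t. U (linepath a b t))) {\<alpha>..\<beta>}"
    using \<mu> by (simp add: mult_ac)
  then show ?thesis
  proof (rule has_integral_spike_finite[of "{\<alpha>, \<beta>}", rotated 2])
    fix t assume t: "t \<in> {\<alpha>..\<beta>} - {\<alpha>, \<beta>}"
    have "(t - \<alpha>) / (\<beta> - \<alpha>) = \<mu> * t - \<alpha> * \<mu>"
      by (simp add: \<mu>_def diff_divide_distrib)
    then show "U (\<gamma> t) * (vector_derivative \<gamma> (at t within {0..1}) $ j) =
        U (linepath a b (\<mu> * t - \<alpha> * \<mu>)) * (\<mu> * (b - a) $ j)"
      using t by (simp add: \<gamma> deriv)
  qed simp
qed

lemma line_integral_triangle_path:
  fixes U :: "real ^ 'k::finite \<Rightarrow> real"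
  assumes U: "continuous_on (convex hull {a, b, c}) U"
  shows "line_integral (triangle_path a b c) U j =
    (b - a) $ j * integral {0..1} (\<lambda>t. U (linepath a b t)) +
    (c - b) $ j * integral {0..1} (\<lambda>t. U (linepath b c t)) +
    (a - c) $ j * integral {0..1} (\<lambda>t. U (linepath c a t))"
proof -
  have U': "continuous_on (closed_segment x y) U" if "{x, y} \<subseteq> {a, b, c}" for x y
    using U by (rule continuous_on_subset) (use that in \<open>simp add: segment_convex_hull hull_mono\<close>)
  let ?f = "\<lambda>t. U (triangle_path a b c t) * (vector_derivative (triangle_path a b c) (at t within {0..1}) $ j)"
  have "(?f has_integral (b - a) $ j * integral {0..1} (\<lambda>t. U (linepath a b t))) {0..1/2}"
    by (rule line_integral_affine_piece[OF _ _ _ U'])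
      (auto simp: triangle_path_def joinpaths_def mult.commute)
  moreover have "(?f has_integral (c - b) $ j * integral {0..1} (\<lambda>t. U (linepath b c t))) {1/2..3/4}"
  proof (rule line_integral_affine_piece[OF _ _ _ U'])
    show "triangle_path a b c t = linepath b c ((t - 1/2) / (3/4 - 1/2))" if "t \<in> {1/2..3/4}" for t
    proof (cases "t = 1/2")
      case True
      show ?thesis
        unfolding True by (simp add: triangle_path_def joinpaths_def linepath_def)
    next
      case False
      then show ?thesis
        using that by (auto simp: triangle_path_def joinpaths_def intro!: arg_cong[of _ _ "linepath b c"])
    qed
  qed auto
  moreover have "(?f has_integral (a - c) $ j * integral {0..1} (\<lambda>t. U (linepath c a t))) {3/4..1}"
  proof (rule line_integral_affine_piece[OF _ _ _ U'])
    show "triangle_path a b c t = linepath c a ((t - 3/4) / (1 - 3/4))" if "t \<in> {3/4..1}" for t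
    proof (cases "t = 3/4")
      case True
      show ?thesis
        unfolding True by (simp add: triangle_path_def joinpaths_def linepath_def)
    next
      case False
      then show ?thesis
        using that by (auto simp: triangle_path_def joinpaths_def intro!: arg_cong[of _ _ "linepath c a"])
    qed
  qed auto
  ultimately have "(?f has_integral ((b - a) $ j * integral {0..1} (\<lambda>t. U (linepath a b t)) +
      (c - b) $ j * integral {0..1} (\<lambda>t. U (linepath b c t))) +
      (a - c) $ j * integral {0..1} (\<lambda>t. U (linepath c a t))) {0..1}"
    by (intro has_integral_combine[where c = "3/4"] has_integral_combine[where c = "1/2" and b = "3/4"]) auto
  then show ?thesis
    unfolding line_integral_def by (rule integral_unique)
qed

section \<open>The Morera theorem\<close>

lemma bounded_linear_E_point: "bounded_linear (E_point e)"
  unfolding E_point_def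
  by (intro bounded_linear_sum bounded_linear_scaleR_const bounded_linear_vec_nth)

lemma E_point_axis: "E_point e (axis j 1) = e j"
proof -
  have "E_point e (axis j 1) = (\<Sum>i\<in>UNIV. if i = j then e i else 0)"
    unfolding E_point_def by (intro sum.cong) (auto simp: axis_def)
  then show ?thesis by simp
qed

locale cartan_coordinates =
  cartan_algebra cscale amul one n m I + bounded_coordinates D p
  for cscale :: "complex \<Rightarrow> 'a::real_normed_vector \<Rightarrow> 'a"
    and amul :: "'a \<Rightarrow> 'a \<Rightarrow> 'a"
    and one :: 'a
    and n m :: nat
    and I :: "nat \<Rightarrow> 'a"
    and D :: "'a set" and p :: "'a \<Rightarrow> 'a \<Rightarrow> real"
begin

sublocale finite_dim_algebra cscale amul one D p
  by unfold_locales

lemma bounded_linear_coord: "bounded_linear (coord cscale n I r)"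
  by (rule linear_bounded[OF linear_coord])

text \<open>
  The definition by real and imaginary parts of coordinates agrees with the vector-valued integral,
  because bounded real-linear functionals commute with integration and the coordinates recover the
  element.
\<close>

lemma curve_integral_triangle_path:
  fixes e :: "'k::finite \<Rightarrow> 'a" and \<Phi> :: "'a \<Rightarrow> 'a"
  assumes cont: "continuous_on (convex hull {a, b, c}) (\<lambda>x. \<Phi> (E_point e x))"
  shows "curve_integral cscale amul n I e (triangle_path a b c) \<Phi> =
    segment_integral (E_point e) (\<lambda>x. \<Phi> (E_point e x)) a b + segment_integral (E_point e) (\<lambda>x. \<Phi> (E_point e x)) b c +
    segment_integral (E_point e) (\<lambda>x. \<Phi> (E_point e x)) c a"
proof -
  define P where "P = (\<lambda>x. \<Phi> (E_point e x))"
  define A where "A = (\<lambda>a b. integral {0..1} (\<lambda>t. P (linepath a b t)))"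
  define V where "V = (\<lambda>j. (b - a) $ j *\<^sub>R A a b + (c - b) $ j *\<^sub>R A b c + (a - c) $ j *\<^sub>R A c a)"
  have P: "continuous_on (convex hull {a, b, c}) P"
    using cont by (simp add: P_def)
  have component: "integral {0..1} (\<lambda>t. L (P (linepath x y t))) = L (A x y)"
    if "{x, y} \<subseteq> {a, b, c}" "bounded_linear L" for x y and L :: "'a \<Rightarrow> real"
  proof -
    have "continuous_on (closed_segment x y) P"
      using P by (rule continuous_on_subset) (use that in \<open>simp add: segment_convex_hull hull_mono\<close>)
    from has_integral_linear[OF continuous_has_integral[OF continuous_on_linepath_compose[OF this]] that(2)]
    show ?thesis
      by (intro integral_unique) (simp add: A_def o_def)
  qed
  have LI: "line_integral (triangle_path a b c) (\<lambda>x. L (P x)) j = L (V j)"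
    if L: "bounded_linear L" for L :: "'a \<Rightarrow> real" and j
  proof -
    interpret L: bounded_linear L by (rule L)
    show ?thesis
      unfolding line_integral_triangle_path[OF L.continuous_on[OF P]]
      by (simp add: component L V_def L.add L.scaleR)
  qed
  have Re: "bounded_linear (\<lambda>x. Re (coord cscale n I r x))"
    and Im: "bounded_linear (\<lambda>x. Im (coord cscale n I r x))" for r
    by (rule bounded_linear_compose[OF bounded_linear_Re bounded_linear_coord]
        bounded_linear_compose[OF bounded_linear_Im bounded_linear_coord])+
  have parts: "(\<Sum>r=1..n. Re (coord cscale n I r x) *\<^sub>R I r) +
      cscale \<i> (\<Sum>r=1..n. Im (coord cscale n I r x) *\<^sub>R I r) = x" for x
  proof -
    have "(\<Sum>r=1..n. cscale (coord cscale n I r x) (I r)) =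
        (\<Sum>r=1..n. Re (coord cscale n I r x) *\<^sub>R I r) +
        (\<Sum>r=1..n. cscale \<i> (Im (coord cscale n I r x) *\<^sub>R I r))"
      unfolding sum.distrib[symmetric]
      by (intro sum.cong refl, subst cscale_decomp) (simp add: linear_scale[OF linear_cscale_right])
    then show ?thesis
      by (simp only: sum_coord linear_sum[OF linear_cscale_right])
  qed
  have pull: "cscale \<i> (\<Sum>j\<in>UNIV. amul (e j) (Y j)) = (\<Sum>j\<in>UNIV. amul (e j) (cscale \<i> (Y j)))"
    for Y :: "'k \<Rightarrow> 'a"
    by (simp only: linear_sum[OF linear_cscale_right] mult_cscale_right)
  have "curve_integral cscale amul n I e (triangle_path a b c) \<Phi> =
      (\<Sum>j\<in>UNIV. amul (e j) (\<Sum>r=1..n. Re (coord cscale n I r (V j)) *\<^sub>R I r)) +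
      cscale \<i> (\<Sum>j\<in>UNIV. amul (e j) (\<Sum>r=1..n. Im (coord cscale n I r (V j)) *\<^sub>R I r))"
    unfolding curve_integral_def using LI[OF Re] LI[OF Im] by (simp only: P_def)
  also have "\<dots> = (\<Sum>j\<in>UNIV. amul (e j) (V j))"
    by (simp only: pull parts flip: sum.distrib mult_add_right)
  also have "\<dots> = segment_integral (E_point e) P a b + segment_integral (E_point e) P b c + segment_integral (E_point e) P c a"
    unfolding segment_integral_def E_point_def V_def A_def
    by (simp only: linear_sum[OF linear_mult_left] mult_scaleR_left mult_scaleR_right
        mult_add_right sum.distrib)
  finally show ?thesis
    by (simp add: P_def)
qed

text \<open>
  In every component of \<open>one = (\<Sum>u=1..m. I u)\<close> surjectivity of the functional provides a
  direction in which it takes the value \<open>\<i>\<close>, so the component of \<open>\<Phi>\<close> has a derivative there.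
  The sum of these derivatives is the derivative of \<open>\<Phi>\<close>.
\<close>

lemma monogenic_of_vanishing_triangle_integrals:
  fixes e :: "'k::finite \<Rightarrow> 'a"
  assumes unit: "one \<in> range e"
    and surjective: "\<forall>u\<in>{1..m}. functional cscale n I u ` E_space e = UNIV"
    and domain: "open (real_coords e \<Omega>)" "\<Omega> \<subseteq> E_space e"
    and continuous: "continuous_in e \<Omega> \<Phi>"
    and triangles: "\<forall>a b c. \<not> collinear {a, b, c} \<longrightarrow>
      closure (triangle a b c) \<subseteq> real_coords e \<Omega> \<longrightarrow>
      curve_integral cscale amul n I e (triangle_path a b c) \<Phi> = 0"
  shows "monogenic_in amul e \<Omega> \<Phi>"
proof -
  define P where "P = (\<lambda>x. \<Phi> (E_point e x))"
  define U where "U = real_coords e \<Omega>"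
  have P: "continuous_on U P"
    using continuous by (simp add: continuous_in_def P_def U_def)
  obtain j1 where j1: "e j1 = one"
    using unit by auto
  have E: "bounded_linear (E_point e)"
    by (rule bounded_linear_E_point)
  have derivative: "\<exists>d. \<forall>v. ((\<lambda>\<epsilon>. P (x0 + \<epsilon> *\<^sub>R v)) has_vector_derivative amul (E_point e v) d) (at 0)"
    if x0: "x0 \<in> U" for x0
  proof -
    obtain \<rho> where \<rho>: "\<rho> > 0" "ball x0 \<rho> \<subseteq> U"
      using domain(1) x0 open_contains_ball unfolding U_def by blast
    have Pball: "continuous_on (ball x0 \<rho>) P"
      using P \<rho>(2) by (rule continuous_on_subset)
    have closed: "segment_integral (E_point e) P a b + segment_integral (E_point e) P b c + segment_integral (E_point e) P c a = 0"
      if abc: "{a, b, c} \<subseteq> ball x0 \<rho>" for a b c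
    proof (cases "collinear {a, b, c}")
      case True
      show ?thesis
        using segment_integral_collinear[OF bounded_linear.linear[OF E] Pball convex_ball abc True] .
    next
      case False
      have hull: "convex hull {a, b, c} \<subseteq> ball x0 \<rho>"
        using abc by (intro hull_minimal) auto
      have "closure (triangle a b c) \<subseteq> real_coords e \<Omega>"
        using hull \<rho>(2) by (simp add: triangle_def U_def closure_closed compact_imp_closed
            finite_imp_compact_convex_hull)
      then have "curve_integral cscale amul n I e (triangle_path a b c) \<Phi> = 0"
        using triangles False by blast
      moreover have "continuous_on (convex hull {a, b, c}) (\<lambda>x. \<Phi> (E_point e x))"
        using continuous_on_subset[OF Pball hull] by (simp add: P_def)
      ultimately show ?thesis
        using curve_integral_triangle_path[of a b c \<Phi> e] unfolding P_def by argo
    qed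
    have prim: "(segment_integral (E_point e) P x0 has_derivative (\<lambda>d. amul (E_point e d) (P x))) (at x)"
      if "x \<in> ball x0 \<rho>" for x
      by (rule primitive[OF E Pball open_ball convex_ball _ that closed]) (use \<rho> in auto)
    have "\<exists>d. \<forall>v. ((\<lambda>\<epsilon>. amul (I u) (P (x0 + \<epsilon> *\<^sub>R v))) has_vector_derivative amul (E_point e v) d) (at 0)"
      if u: "u \<in> {1..m}" for u
    proof -
      have "\<i> \<in> functional cscale n I u ` E_space e"
        using surjective u by simp
      then obtain v2 where v2: "\<i> = functional cscale n I u (E_point e v2)"
        by (auto simp: E_space_def)
      have "u \<in> {1..n}"
        using u m_le_n by auto
      then have coord: "coord cscale n I u (E_point e v2) = \<i>"
        by (simp only: functional_eq_coord v2)
      obtain \<nu> where \<nu>: "amul (I u) (E_point e v2) = cscale \<i> (I u) + \<nu>"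
        "amul (I u) \<nu> = \<nu>" "(amul \<nu> ^^ Suc (n - m)) (I u) = 0"
        using local_component[OF u, of "E_point e v2"] coord by metis
      interpret elliptic_direction cscale amul one D p "I u" "E_point e v2" \<nu> "Suc (n - m)"
        by unfold_locales (use \<nu> idempotents u in auto)
      show ?thesis
        by (rule component_derivative[OF E _ refl prim Pball \<rho>(1), where ?v1.0 = "axis j1 1"])
          (simp_all add: E_point_axis j1)
    qed
    then obtain d where d: "\<And>u v. u \<in> {1..m} \<Longrightarrow>
        ((\<lambda>\<epsilon>. amul (I u) (P (x0 + \<epsilon> *\<^sub>R v))) has_vector_derivative amul (E_point e v) (d u)) (at 0)"
      by metis
    have decompose: "(\<Sum>u=1..m. amul (I u) x) = x" for x
      using left_neutral[of x]
      by (simp only: one_eq_sum_idempotents linear_sum[OF linear_mult_left])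
    have "((\<lambda>\<epsilon>. P (x0 + \<epsilon> *\<^sub>R v)) has_vector_derivative amul (E_point e v) (\<Sum>u=1..m. d u)) (at 0)" for v
    proof -
      have "((\<lambda>\<epsilon>. \<Sum>u=1..m. amul (I u) (P (x0 + \<epsilon> *\<^sub>R v))) has_vector_derivative
          (\<Sum>u=1..m. amul (E_point e v) (d u))) (at 0)"
        by (intro has_vector_derivative_sum d)
      then show ?thesis
        by (simp only: decompose linear_sum[OF linear_mult_right])
    qed
    then show ?thesis by blast
  qed
  have "\<exists>d. \<forall>h\<in>E_space e.
      ((\<lambda>\<epsilon>. (1 / \<epsilon>) *\<^sub>R (\<Phi> (\<zeta> + \<epsilon> *\<^sub>R h) - \<Phi> \<zeta>)) \<longlongrightarrow> amul h d) (at_right 0)"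
    if \<zeta>: "\<zeta> \<in> \<Omega>" for \<zeta>
  proof -
    interpret E: bounded_linear "E_point e" by (rule E)
    obtain x0 where x0: "\<zeta> = E_point e x0" "x0 \<in> U"
      using \<zeta> domain(2) by (auto simp: E_space_def U_def real_coords_def)
    obtain d where d: "\<And>v. ((\<lambda>\<epsilon>. P (x0 + \<epsilon> *\<^sub>R v)) has_vector_derivative amul (E_point e v) d) (at 0)"
      using derivative[OF x0(2)] by blast
    have "((\<lambda>\<epsilon>. (1 / \<epsilon>) *\<^sub>R (\<Phi> (\<zeta> + \<epsilon> *\<^sub>R h) - \<Phi> \<zeta>)) \<longlongrightarrow> amul h d) (at_right 0)"
      if h: "h \<in> E_space e" for h
    proof -
      obtain v where v: "h = E_point e v"
        using h by (auto simp: E_space_def)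
      have "((\<lambda>\<epsilon>. P (x0 + \<epsilon> *\<^sub>R v)) has_vector_derivative amul h d) (at_right 0)"
        using d[of v] unfolding v by (rule has_vector_derivative_at_within)
      then have "((\<lambda>\<epsilon>. (1 / norm (\<epsilon> - 0)) *\<^sub>R (P (x0 + \<epsilon> *\<^sub>R v) -
          (P (x0 + 0 *\<^sub>R v) + (\<epsilon> - 0) *\<^sub>R amul h d))) \<longlongrightarrow> 0) (at_right 0)"
        unfolding has_vector_derivative_def has_derivative_within by blast
      moreover have "eventually (\<lambda>\<epsilon>. (1 / norm (\<epsilon> - 0)) *\<^sub>R (P (x0 + \<epsilon> *\<^sub>R v) -
          (P (x0 + 0 *\<^sub>R v) + (\<epsilon> - 0) *\<^sub>R amul h d)) =
          (1 / \<epsilon>) *\<^sub>R (\<Phi> (\<zeta> + \<epsilon> *\<^sub>R h) - \<Phi> \<zeta>) - amul h d) (at_right 0)"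
        using eventually_at_right_less[of "0::real"]
      proof (rule eventually_mono)
        fix \<epsilon> :: real assume "0 < \<epsilon>"
        then show "(1 / norm (\<epsilon> - 0)) *\<^sub>R (P (x0 + \<epsilon> *\<^sub>R v) -
            (P (x0 + 0 *\<^sub>R v) + (\<epsilon> - 0) *\<^sub>R amul h d)) =
            (1 / \<epsilon>) *\<^sub>R (\<Phi> (\<zeta> + \<epsilon> *\<^sub>R h) - \<Phi> \<zeta>) - amul h d"
          by (simp add: P_def x0(1) v E.add E.scaleR scaleR_diff_right scaleR_add_right)
      qed
      ultimately have "((\<lambda>\<epsilon>. (1 / \<epsilon>) *\<^sub>R (\<Phi> (\<zeta> + \<epsilon> *\<^sub>R h) - \<Phi> \<zeta>) - amul h d) \<longlongrightarrow> 0) (at_right 0)"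
        by (rule Lim_transform_eventually)
      then show ?thesis
        by (rule LIM_zero_cancel)
    qed
    then show ?thesis by blast
  qed
  then show ?thesis
    using continuous by (simp add: monogenic_in_def)
qed

end

theorem theorem3:
  fixes cscale :: "complex \<Rightarrow> 'a::real_normed_vector \<Rightarrow> 'a"
    and amul :: "'a \<Rightarrow> 'a \<Rightarrow> 'a"
    and one :: 'a
    and n m :: nat
    and I :: "nat \<Rightarrow> 'a"
    and e :: "'k::finite \<Rightarrow> 'a"
    and j1 :: 'k
    and \<Omega> :: "'a set"
    and \<Phi> :: "'a \<Rightarrow> 'a"
  assumes algebra: "cartan_algebra cscale amul one n m I"
    and k: "2 \<le> CARD('k)" "CARD('k) \<le> 2 * n"
    and e1: "e j1 = one"
    and e_independent: "inj e" "independent (range e)"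
    and surjective: "\<forall>u\<in>{1..m}. functional cscale n I u ` E_space e = UNIV"
    and domain: "domain_in e \<Omega>"
    and continuous: "continuous_in e \<Omega> \<Phi>"
    and triangles: "\<forall>a b c. \<not> collinear {a, b, c} \<longrightarrow>
      closure (triangle a b c) \<subseteq> real_coords e \<Omega> \<longrightarrow>
      curve_integral cscale amul n I e (triangle_path a b c) \<Phi> = 0"
  shows "monogenic_in amul e \<Omega> \<Phi>"
proof -
  interpret cartan_algebra cscale amul one n m I by (rule algebra)
  obtain D :: "'a set" and p where "bounded_coordinates D p"
    using bounded_coordinates_exist[OF _ basis_real_span] by auto
  then interpret cartan_coordinates cscale amul one n m I D p
    by (intro cartan_coordinates.intro algebra)
  show ?thesis
  proof (rule monogenic_of_vanishing_triangle_integrals[OF _ surjective _ _ continuous triangles])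
    show "one \<in> range e"
      using e1 by (metis rangeI)
  qed (use domain in \<open>auto simp: domain_in_def\<close>)
qed

end
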